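(* Let $\mathfrak{v}=\{\nu_i\}_{i\in I}$ be a totally ordered set in $\mathcal{V}$ such that $\mathfrak{v}$ has no maximum and there is at least one polynomial in $\mathbb{K}[x]$ that is not $\mathfrak{v}$-stable. Let $Q$ be a monic polynomial of smallest degree $d$ that is not $\mathfrak{v}$-stable and take $\gamma\in\Gamma_\infty$ such that $\gamma>\nu_i(Q)$ for every $i\in I$. Let $\mu\in\mathcal{V}$ be the valuation on $\mathbb{K}[x]$ given by $$\mu(f_0+f_1Q+\cdots+f_rQ^r)=\min_{0\le j\le r}\{\mathfrak{v}(f_j)+j\gamma\},$$ where $f_0+f_1Q+\cdots+f_rQ^r$ is the $Q$-expansion of $f$ (that is, $\deg(f_j)<d$ for all $j$), and let $R_Q$ be the additive subgroup of $\mathcal{G}_\mu$ generated by $\{\mathrm{in}_\mu(f)\mid f\in\mathbb{K}[x],\ \deg(f)<d\}$ (it is a subring of $\mathcal{G}_\mu$). Consider the direct system $\{(\mathcal{G}_{\nu_i},\phi_{ij})\}_{i\le j}^{i,j\in I}$. Then $\varinjlim\mathcal{G}_{\nu_i}\cong R_Q$ as commutative rings with unity.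
   Context: A valuation on a commutative ring $A$ with unity is a map $\nu:A\to\Gamma_\infty=\Gamma\cup\{\infty\}$, with $\Gamma$ a totally ordered abelian group, such that $\nu(ab)=\nu(a)+\nu(b)$, $\nu(a+b)\ge\min\{\nu(a),\nu(b)\}$, $\nu(1)=0$, $\nu(0)=\infty$. Its support is $\mathrm{supp}(\nu)=\{a\mid\nu(a)=\infty\}$, which may be non-zero. Let $\mathbb{K}$ be a field, $\nu_0$ a valuation on $\mathbb{K}$ with support $\{0\}$ and value group $\Gamma_0$, and fix a totally ordered divisible abelian group $\Gamma\supseteq\Gamma_0$. Put $\mathcal{V}=\{\nu_0\}\cup\{\nu:\mathbb{K}[x]\to\Gamma_\infty\mid \nu\text{ is a valuation extending }\nu_0\}$, partially ordered by $\nu_0\le\nu$ for all $\nu\in\mathcal{V}$, and, for $\nu,\mu\in\mathcal{V}\setminus\{\nu_0\}$, $\nu\le\mu$ iff $\nu(f)\le\mu(f)$ for all $f\in\mathbb{K}[x]$. The families $\mathfrak{v}=\{\nu_i\}_{i\in I}$ considered are non-empty and consist of valuations on $\mathbb{K}[x]$; $I$ carries the induced total order ($i\le j$ iff $\nu_i\le\nu_j$). A polynomial $f\in\mathbb{K}[x]$ is $\mathfrak{v}$-stable if there is $i_f\in I$ with $\nu_i(f)=\nu_{i_f}(f)$ for every $i\in I$ with $i\ge i_f$; then $\mathfrak{v}(f)=\nu_{i_f}(f)$. Graded ring: for a valuation $\nu$ on $\mathbb{K}[x]$ and $\gamma\in\nu(\mathbb{K}[x]\setminus\mathrm{supp}(\nu))$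 let $\mathcal{P}_\gamma=\{f\mid\nu(f)\ge\gamma\}$, $\mathcal{P}_\gamma^+=\{f\mid\nu(f)>\gamma\}$; then $\mathcal{G}_\nu=\bigoplus_\gamma\mathcal{P}_\gamma/\mathcal{P}_\gamma^+$, with product extending $(f+\mathcal{P}_\beta^+)(g+\mathcal{P}_\gamma^+)=fg+\mathcal{P}_{\beta+\gamma}^+$ for $\nu(f)=\beta$, $\nu(g)=\gamma$. For $f\notin\mathrm{supp}(\nu)$, $\mathrm{in}_\nu(f)$ is the image of $f$ in $\mathcal{P}_{\nu(f)}/\mathcal{P}_{\nu(f)}^+$; for $f\in\mathrm{supp}(\nu)$, $\mathrm{in}_\nu(f)=0$. For $i\le j$, $\phi_{ij}:\mathcal{G}_{\nu_i}\to\mathcal{G}_{\nu_j}$ is the (well-defined) ring homomorphism obtained by additive extension from $\mathrm{in}_{\nu_i}(f)\mapsto\mathrm{in}_{\nu_j}(f)$ if $\nu_i(f)=\nu_j(f)$ and $\mathrm{in}_{\nu_i}(f)\mapsto0$ if $\nu_i(f)<\nu_j(f)$. These maps form a direct system over $I$. *)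

theory Defs
  imports
    "HOL-Algebra.QuotRing"
    "HOL-Algebra.Product_Groups"
    "HOL-Algebra.Generated_Groups"
    "HOL-Computational_Algebra.Polynomial"
begin

section \<open>Adjoining an infinite element to an ordered group\<close>

datatype 'g with_inf = Fin 'g | Infty

instantiation with_inf :: (linorder) linorder
begin

definition less_eq_with_inf :: "'a::linorder with_inf \<Rightarrow> 'a with_inf \<Rightarrow> bool" where
  "a \<le> b \<longleftrightarrow> (case b of Infty \<Rightarrow> True
                  | Fin y \<Rightarrow> (case a of Infty \<Rightarrow> False | Fin x \<Rightarrow> x \<le> y))"

definition less_with_inf :: "'a::linorder with_inf \<Rightarrow> 'a with_inf \<Rightarrow> bool" where
  "a < b \<longleftrightarrow> (case a of Infty \<Rightarrow> False
                  | Fin x \<Rightarrow> (case b of Infty \<Rightarrow> True | Fin y \<Rightarrow> x < y))"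

instance
  by standard
    (auto simp: less_eq_with_inf_def less_with_inf_def split: with_inf.splits)

end

instantiation with_inf :: (comm_monoid_add) comm_monoid_add
begin

definition zero_with_inf :: "'a::comm_monoid_add with_inf" where
  "0 = Fin 0"

definition plus_with_inf :: "'a::comm_monoid_add with_inf \<Rightarrow> 'a with_inf \<Rightarrow> 'a with_inf" where
  "a + b = (case a of Infty \<Rightarrow> Infty
              | Fin x \<Rightarrow> (case b of Infty \<Rightarrow> Infty | Fin y \<Rightarrow> Fin (x + y)))"

instance
  by standard
    (auto simp: zero_with_inf_def plus_with_inf_def ac_simps
          split: with_inf.splits)

end

text \<open>The multiple \<open>n \<cdot> x\<close>; in particular \<open>0 \<cdot> Infty = 0\<close>.\<close>

definition nmul :: "nat \<Rightarrow> 'a::comm_monoid_add \<Rightarrow> 'a" where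
  "nmul n x = (\<Sum>_<n. x)"

definition divisible_group :: "'g::ab_group_add itself \<Rightarrow> bool" where
  "divisible_group _ \<longleftrightarrow> (\<forall>n>0. \<forall>g::'g. \<exists>h. nmul n h = g)"


section \<open>Valuations\<close>

definition valuation ::
    "('a::comm_ring_1 \<Rightarrow> 'g::linordered_ab_group_add with_inf) \<Rightarrow> bool" where
  "valuation \<nu> \<longleftrightarrow>
     (\<forall>a b. \<nu> (a * b) = \<nu> a + \<nu> b) \<and>
     (\<forall>a b. min (\<nu> a) (\<nu> b) \<le> \<nu> (a + b)) \<and>
     \<nu> 1 = 0 \<and> \<nu> 0 = Infty"

definition val_support :: "('a \<Rightarrow> 'g with_inf) \<Rightarrow> 'a set" where
  "val_support \<nu> = {a. \<nu> a = Infty}"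

text \<open>The set \<open>\<V> - {\<nu>\<^sub>0}\<close> of valuations on the polynomial ring that extend \<open>\<nu>\<^sub>0\<close>.
  Its partial order is the pointwise order \<open>\<le>\<close> of the function space.  The extra least
  element \<open>\<nu>\<^sub>0\<close> of \<open>\<V>\<close>, which has a different domain, never belongs to the families below.\<close>

definition extensions ::
    "('k::field \<Rightarrow> 'g::linordered_ab_group_add with_inf) \<Rightarrow> ('k poly \<Rightarrow> 'g with_inf) set" where
  "extensions \<nu>0 = {\<nu>. valuation \<nu> \<and> (\<forall>a. \<nu> [:a:] = \<nu>0 a)}"

definition v_stable ::
    "'i set \<Rightarrow> ('i \<Rightarrow> 'a \<Rightarrow> 'g::linorder with_inf) \<Rightarrow> 'a \<Rightarrow> bool" where
  "v_stable I \<nu> f \<longleftrightarrow> (\<exists>i\<in>I. \<forall>j\<in>I. \<nu> i \<le> \<nu> j \<longrightarrow> \<nu> j f = \<nu> i f)"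

definition stable_value ::
    "'i set \<Rightarrow> ('i \<Rightarrow> 'a \<Rightarrow> 'g::linorder with_inf) \<Rightarrow> 'a \<Rightarrow> 'g with_inf" where
  "stable_value I \<nu> f =
     (THE \<gamma>. \<exists>i\<in>I. (\<forall>j\<in>I. \<nu> i \<le> \<nu> j \<longrightarrow> \<nu> j f = \<nu> i f) \<and> \<gamma> = \<nu> i f)"


section \<open>The graded ring of a valuation\<close>

definition value_set :: "('k::field poly \<Rightarrow> 'g with_inf) \<Rightarrow> 'g set" where
  "value_set \<nu> = {\<gamma>. \<exists>f. f \<notin> val_support \<nu> \<and> \<nu> f = Fin \<gamma>}"

definition P_ge :: "('k::field poly \<Rightarrow> 'g::linorder with_inf) \<Rightarrow> 'g \<Rightarrow> 'k poly set" where
  "P_ge \<nu> \<gamma> = {f. \<nu> f \<ge> Fin \<gamma>}"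

definition P_gt :: "('k::field poly \<Rightarrow> 'g::linorder with_inf) \<Rightarrow> 'g \<Rightarrow> 'k poly set" where
  "P_gt \<nu> \<gamma> = {f. \<nu> f > Fin \<gamma>}"

text \<open>Additive groups are written as multiplicative records, as the library quotients and
  direct sums of groups require.\<close>

definition P_group ::
    "('k::field poly \<Rightarrow> 'g::linorder with_inf) \<Rightarrow> 'g \<Rightarrow> 'k poly monoid" where
  "P_group \<nu> \<gamma> = \<lparr>carrier = P_ge \<nu> \<gamma>, monoid.mult = (+), one = 0\<rparr>"

definition piece ::
    "('k::field poly \<Rightarrow> 'g::linorder with_inf) \<Rightarrow> 'g \<Rightarrow> 'k poly set monoid" where
  "piece \<nu> \<gamma> = P_group \<nu> \<gamma> Mod P_gt \<nu> \<gamma>"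

definition pcoset ::
    "('k::field poly \<Rightarrow> 'g::linorder with_inf) \<Rightarrow> 'g \<Rightarrow> 'k poly \<Rightarrow> 'k poly set" where
  "pcoset \<nu> \<gamma> f = P_gt \<nu> \<gamma> #>\<^bsub>P_group \<nu> \<gamma>\<^esub> f"

definition graded_group ::
    "('k::field poly \<Rightarrow> 'g::linorder with_inf) \<Rightarrow> ('g \<Rightarrow> 'k poly set) monoid" where
  "graded_group \<nu> = sum_group (value_set \<nu>) (piece \<nu>)"

definition gsupp ::
    "('k::field poly \<Rightarrow> 'g::linorder with_inf) \<Rightarrow> ('g \<Rightarrow> 'k poly set) \<Rightarrow> 'g set" where
  "gsupp \<nu> s = {\<gamma> \<in> value_set \<nu>. s \<gamma> \<noteq> \<one>\<^bsub>piece \<nu> \<gamma>\<^esub>}"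

text \<open>The class of \<open>f\<close> placed in degree \<open>\<nu> f\<close>, and \<open>0\<close> for \<open>f\<close> in the support.\<close>

definition initial ::
    "('k::field poly \<Rightarrow> 'g::linorder with_inf) \<Rightarrow> 'k poly \<Rightarrow> 'g \<Rightarrow> 'k poly set" where
  "initial \<nu> f =
     (case \<nu> f of
        Infty \<Rightarrow> \<one>\<^bsub>graded_group \<nu>\<^esub>
      | Fin \<beta> \<Rightarrow> (\<lambda>\<gamma>\<in>value_set \<nu>. if \<gamma> = \<beta> then pcoset \<nu> \<gamma> f else \<one>\<^bsub>piece \<nu> \<gamma>\<^esub>))"

text \<open>Product of a class of degree \<open>\<beta>\<close> with a class of degree \<open>\<gamma>\<close>; the union is over all
  representatives, and all the cosets united coincide.\<close>

definition pmult ::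
    "('k::field poly \<Rightarrow> 'g::linordered_ab_group_add with_inf) \<Rightarrow> 'g \<Rightarrow> 'g
      \<Rightarrow> 'k poly set \<Rightarrow> 'k poly set \<Rightarrow> 'k poly set" where
  "pmult \<nu> \<beta> \<gamma> A B = (\<Union>f\<in>A. \<Union>g\<in>B. pcoset \<nu> (\<beta> + \<gamma>) (f * g))"

text \<open>Since \<open>piece\<close> is written multiplicatively, \<open>finprod\<close> is the sum of classes.\<close>

definition graded_mult ::
    "('k::field poly \<Rightarrow> 'g::linordered_ab_group_add with_inf)
      \<Rightarrow> ('g \<Rightarrow> 'k poly set) \<Rightarrow> ('g \<Rightarrow> 'k poly set) \<Rightarrow> 'g \<Rightarrow> 'k poly set" where
  "graded_mult \<nu> s t =
     (\<lambda>\<gamma>\<in>value_set \<nu>.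
        finprod (piece \<nu> \<gamma>) (\<lambda>(\<alpha>, \<beta>). pmult \<nu> \<alpha> \<beta> (s \<alpha>) (t \<beta>))
          {(\<alpha>, \<beta>). \<alpha> \<in> gsupp \<nu> s \<and> \<beta> \<in> gsupp \<nu> t \<and> \<alpha> + \<beta> = \<gamma>})"

definition graded_ring ::
    "('k::field poly \<Rightarrow> 'g::linordered_ab_group_add with_inf) \<Rightarrow> ('g \<Rightarrow> 'k poly set) ring" where
  "graded_ring \<nu> =
     \<lparr>carrier = carrier (graded_group \<nu>),
      monoid.mult = graded_mult \<nu>,
      one = initial \<nu> 1,
      zero = \<one>\<^bsub>graded_group \<nu>\<^esub>,
      add = monoid.mult (graded_group \<nu>)\<rparr>"

text \<open>The transition map for \<open>\<nu> \<le> \<mu>\<close>: an element \<open>s\<close> is the sum, over \<open>\<gamma>\<close> in its support, of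
  the initial forms \<open>initial \<nu> f\<close> with \<open>f \<in> s \<gamma>\<close> (any such \<open>f\<close> has \<open>\<nu> f = Fin \<gamma>\<close>); each summand
  is sent to \<open>initial \<mu> f\<close> or to \<open>0\<close>, independently of the choice of \<open>f\<close>.\<close>

definition graded_map ::
    "('k::field poly \<Rightarrow> 'g::linordered_ab_group_add with_inf) \<Rightarrow> ('k poly \<Rightarrow> 'g with_inf)
      \<Rightarrow> ('g \<Rightarrow> 'k poly set) \<Rightarrow> ('g \<Rightarrow> 'k poly set)" where
  "graded_map \<nu> \<mu> s =
     finsum (graded_ring \<mu>)
       (\<lambda>\<gamma>. let f = (SOME f. f \<in> s \<gamma>)
             in if \<nu> f = \<mu> f then initial \<mu> f else \<zero>\<^bsub>graded_ring \<mu>\<^esub>)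
       (gsupp \<nu> s)"

definition R_sub ::
    "('k::field poly \<Rightarrow> 'g::linordered_ab_group_add with_inf) \<Rightarrow> nat
      \<Rightarrow> ('g \<Rightarrow> 'k poly set) ring" where
  "R_sub \<mu> d =
     (graded_ring \<mu>)
       \<lparr>carrier := generate (add_monoid (graded_ring \<mu>)) {initial \<mu> f | f. degree f < d}\<rparr>"


section \<open>Direct limits of rings\<close>

text \<open>The standard construction for a system indexed by a directed set \<open>(I, leq)\<close>: the disjoint
  union of the carriers modulo eventual equality, with operations computed at any common
  upper bound \<open>k\<close>.\<close>

definition lim_rel ::
    "'i set \<Rightarrow> ('i \<Rightarrow> 'i \<Rightarrow> bool) \<Rightarrow> ('i \<Rightarrow> 'a ring) \<Rightarrow> ('i \<Rightarrow> 'i \<Rightarrow> 'a \<Rightarrow> 'a)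
      \<Rightarrow> (('i \<times> 'a) \<times> ('i \<times> 'a)) set" where
  "lim_rel I leq G \<phi> =
     {((i, a), (j, b)) | i a j b.
        i \<in> I \<and> a \<in> carrier (G i) \<and> j \<in> I \<and> b \<in> carrier (G j) \<and>
        (\<exists>k\<in>I. leq i k \<and> leq j k \<and> \<phi> i k a = \<phi> j k b)}"

definition direct_limit ::
    "'i set \<Rightarrow> ('i \<Rightarrow> 'i \<Rightarrow> bool) \<Rightarrow> ('i \<Rightarrow> 'a ring) \<Rightarrow> ('i \<Rightarrow> 'i \<Rightarrow> 'a \<Rightarrow> 'a)
      \<Rightarrow> ('i \<times> 'a) set ring" where
  "direct_limit I leq G \<phi> =
     (let r = lim_rel I leq G \<phi>;
          lift = (\<lambda>opr X Y.
            \<Union> {r `` {(k, opr (G k) (\<phi> i k a) (\<phi> j k b))} | i a j b k.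
                 (i, a) \<in> X \<and> (j, b) \<in> Y \<and> k \<in> I \<and> leq i k \<and> leq j k})
      in \<lparr>carrier = (SIGMA i:I. carrier (G i)) // r,
          monoid.mult = lift monoid.mult,
          one = (\<Union>i\<in>I. r `` {(i, \<one>\<^bsub>G i\<^esub>)}),
          zero = (\<Union>i\<in>I. r `` {(i, \<zero>\<^bsub>G i\<^esub>)}),
          add = lift add\<rparr>)"

end

theory Submission
  imports Defs "HOL-Library.Poly_Mapping"
begin

text \<open>
  Let \<open>G\<^sub>\<nu>\<close> denote the graded ring of \<open>\<nu>\<close>. The members of the chain lie below \<open>\<mu>\<close>, so there are maps
  from each \<open>G\<^sub>\<nu>\<close> to \<open>G\<^sub>\<mu>\<close>, and they induce a homomorphism from the direct limit to \<open>G\<^sub>\<mu>\<close>. It has to be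
  shown that this is injective with image \<open>R_sub \<mu> (degree Q)\<close>.

  The valuation-theoretic input is a formula for late members \<open>\<nu> k\<close> of the chain. In a \<open>Q\<close>-expansion
  \<open>p = f\<^sub>0 + f\<^sub>1 Q + \<dots>\<close> the coefficients have degree smaller than \<open>Q\<close>, hence are stable, and the value of
  \<open>f\<^sub>j Q\<^sup>j\<close> is a line of slope \<open>j\<close> in the value of \<open>Q\<close>. As that value keeps growing, it eventually
  avoids the finitely many points where two lines cross. Then the terms have distinct values and
  \<open>\<nu> k p\<close> is the minimum of the lines at \<open>\<nu> k Q\<close> (lemma \<open>eventually_value_expansion\<close>), while \<open>\<mu> p\<close> is
  their minimum at the larger point \<open>\<gamma>\<close>. Three consequences follow:

  \<^item> \<open>\<nu> i \<le> \<mu>\<close> (lemma \<open>chain_le_\<mu>\<close>).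

  \<^item> If \<open>\<nu> i p < \<mu> p\<close>, then the value of \<open>p\<close> grows further along the chain, because a constant minimum can
    only be reached by the line of slope \<open>0\<close> (lemma \<open>value_grows_below_\<mu>\<close>). This gives injectivity: a
    class that dies in \<open>G\<^sub>\<mu>\<close> dies at some stage.

  \<^item> If \<open>\<nu> i p = \<mu> p\<close> is finite, then only the line of slope \<open>0\<close> reaches the minimum at \<open>\<gamma>\<close>, so \<open>p\<close> has the
    initial form of \<open>f\<^sub>0\<close> (lemma \<open>initial_form_of_small_degree\<close>). So the image lies in the subgroup
    generated by the initial forms of polynomials of small degree; it contains them, as these
    polynomials are stable.

  The algebra is organised so that the ring structures never have to be compared directly. The graded
  ring of \<open>\<nu>\<close> is the quotient of its Rees algebra \<open>rees \<nu>\<close>, a subring of the monoid algebra of the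
  value group over the polynomials, and for \<open>\<nu> \<le> \<mu>\<close> the transition map is induced by the inclusion
  \<open>rees \<nu> \<subseteq> rees \<mu>\<close> (lemmas \<open>presents_graded_ring\<close> and \<open>graded_map_graded_class\<close>). Consequently the
  direct limit and \<open>R_sub \<mu> (degree Q)\<close> are both quotients of the union of the algebras \<open>rees (\<nu> i)\<close>
  (lemmas \<open>presents_direct_limit\<close> and \<open>presents_R_sub\<close>), and the isomorphism reduces to the equality of
  the two identifications (lemma \<open>graded_class_\<mu>_eq_iff\<close>).
\<close>

section \<open>Rings presented as images of subrings\<close>

definition subring_of :: "'a::comm_ring_1 set \<Rightarrow> bool" where
  "subring_of U \<longleftrightarrow> 0 \<in> U \<and> 1 \<in> U \<and> (\<forall>x\<in>U. \<forall>y\<in>U. x + y \<in> U \<and> x * y \<in> U) \<and> (\<forall>x\<in>U. - x \<in> U)"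

text \<open>A ring \<open>R\<close> is handled through a surjective homomorphism from a subring \<open>U\<close> of an ambient
  commutative ring that is a type: the ring axioms of \<open>R\<close> are then inherited, and \<open>R\<close> is known up to
  isomorphism once it is known which elements of \<open>U\<close> the map identifies.\<close>

definition presents :: "'a::comm_ring_1 set \<Rightarrow> ('a \<Rightarrow> 'b) \<Rightarrow> 'b ring \<Rightarrow> bool" where
  "presents U c R \<longleftrightarrow> subring_of U \<and> c ` U = carrier R \<and> c 0 = \<zero>\<^bsub>R\<^esub> \<and> c 1 = \<one>\<^bsub>R\<^esub> \<and>
     (\<forall>x\<in>U. \<forall>y\<in>U. c (x + y) = c x \<oplus>\<^bsub>R\<^esub> c y \<and> c (x * y) = c x \<otimes>\<^bsub>R\<^esub> c y)"

lemma subring_of_closed: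
  assumes "subring_of U"
  shows "0 \<in> U" "1 \<in> U" "\<And>x y. x \<in> U \<Longrightarrow> y \<in> U \<Longrightarrow> x + y \<in> U"
    "\<And>x y. x \<in> U \<Longrightarrow> y \<in> U \<Longrightarrow> x * y \<in> U" "\<And>x. x \<in> U \<Longrightarrow> - x \<in> U"
    "\<And>x y. x \<in> U \<Longrightarrow> y \<in> U \<Longrightarrow> x - y \<in> U"
proof -
  show "x - y \<in> U" if "x \<in> U" "y \<in> U" for x y
    using assms that unfolding subring_of_def by (metis add_uminus_conv_diff)
qed (use assms in \<open>auto simp: subring_of_def\<close>)

lemma subring_of_sum:
  assumes "subring_of U" "\<And>i. i \<in> A \<Longrightarrow> h i \<in> U"
  shows "sum h A \<in> U"
  using assms(2) by (induction A rule: infinite_finite_induct) (auto simp: subring_of_closed[OF assms(1)])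

lemma presentsD:
  assumes "presents U c R"
  shows "subring_of U" "c ` U = carrier R" "c 0 = \<zero>\<^bsub>R\<^esub>" "c 1 = \<one>\<^bsub>R\<^esub>"
    "\<And>x y. x \<in> U \<Longrightarrow> y \<in> U \<Longrightarrow> c (x + y) = c x \<oplus>\<^bsub>R\<^esub> c y"
    "\<And>x y. x \<in> U \<Longrightarrow> y \<in> U \<Longrightarrow> c (x * y) = c x \<otimes>\<^bsub>R\<^esub> c y"
  using assms by (auto simp: presents_def)

lemma presents_cring:
  assumes "presents U c R"
  shows "cring R"
proof -
  note D = presentsD[OF assms]
  note U = subring_of_closed[OF D(1)]
  have ex: "\<exists>x\<in>U. a = c x" if "a \<in> carrier R" for a
    using that D(2) by blast
  have mem: "c x \<in> carrier R" if "x \<in> U" for x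
    using that D(2) by blast
  have [simp]: "c x \<oplus>\<^bsub>R\<^esub> c y = c (x + y)" "c x \<otimes>\<^bsub>R\<^esub> c y = c (x * y)" if "x \<in> U" "y \<in> U" for x y
    using that D by auto
  have [simp]: "\<zero>\<^bsub>R\<^esub> = c 0" "\<one>\<^bsub>R\<^esub> = c 1" using D by auto
  show ?thesis
  proof (rule cringI)
    show "abelian_group R"
    proof (rule abelian_groupI)
      fix a assume "a \<in> carrier R"
      then obtain x where "x \<in> U" "a = c x" using ex by blast
      then show "\<exists>b\<in>carrier R. b \<oplus>\<^bsub>R\<^esub> a = \<zero>\<^bsub>R\<^esub>"
        by (intro bexI[of _ "c (- x)"]) (auto simp: U mem)
    qed (auto dest!: ex simp: U mem ac_simps)
    show "comm_monoid R"
      by (rule comm_monoidI) (auto dest!: ex simp: U mem ac_simps)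
  qed (auto dest!: ex simp: U mem algebra_simps)
qed

lemma presents_finsum:
  assumes "presents U c R" "finite A" "\<And>i. i \<in> A \<Longrightarrow> h i \<in> U"
  shows "finsum R (\<lambda>i. c (h i)) A = c (sum h A)"
proof -
  interpret cring R by (rule presents_cring[OF assms(1)])
  note D = presentsD[OF assms(1)]
  show ?thesis
    using assms(2,3)
  proof (induction A rule: finite_induct)
    case (insert a A)
    have "(\<lambda>i. c (h i)) \<in> A \<rightarrow> carrier R" "c (h a) \<in> carrier R"
      using insert.prems D(2) by blast+
    then have "finsum R (\<lambda>i. c (h i)) (insert a A) = c (h a) \<oplus>\<^bsub>R\<^esub> finsum R (\<lambda>i. c (h i)) A"
      using insert.hyps by (intro finsum_insert) auto
    then show ?case
      using insert by (simp add: D(5) subring_of_sum[OF D(1)])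
  qed (simp add: D)
qed

lemma presents_subring:
  assumes "presents U c R" "subring_of V" "V \<subseteq> U"
  shows "presents V c (R\<lparr>carrier := c ` V\<rparr>)"
  using assms by (auto simp: presents_def subset_iff)

lemma presents_same_kernel_iso:
  assumes "presents U c R" "presents U c' R'"
    and kernel: "\<And>x y. x \<in> U \<Longrightarrow> y \<in> U \<Longrightarrow> c x = c y \<longleftrightarrow> c' x = c' y"
  shows "R \<simeq> R'"
proof -
  note D = presentsD[OF assms(1)] and D' = presentsD[OF assms(2)]
  note U = subring_of_closed[OF D(1)]
  define h where "h a = c' (inv_into U c a)" for a
  have h: "h (c x) = c' x" if "x \<in> U" for x
  proof -
    have "inv_into U c (c x) \<in> U" "c (inv_into U c (c x)) = c x"
      using that by (auto intro: inv_into_into f_inv_into_f)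
    then show ?thesis unfolding h_def using kernel that by blast
  qed
  have "h \<in> ring_hom R R'"
    unfolding ring_hom_def
    by (auto simp: D(2)[symmetric] D(4)[symmetric] D(5,6)[symmetric] h U D'(4,5,6) simp flip: D'(2))
  moreover have "bij_betw h (carrier R) (carrier R')"
    unfolding D(2)[symmetric] D'(2)[symmetric] bij_betw_def
    by (auto simp: inj_on_def h kernel image_image cong: image_cong)
  ultimately show ?thesis
    unfolding is_ring_iso_def ring_iso_def by blast
qed

text \<open>If a chain of rings is presented by an increasing chain of subrings, compatibly with the
  transition maps, then the direct limit is presented by the union of the subrings: \<open>x\<close> goes to the
  common class of all pairs \<open>(i, c i x)\<close> with \<open>x \<in> U i\<close>, and two elements are identified exactly when
  some stage identifies them. That the \<open>\<phi> i j\<close> are homomorphisms that compose correctly is a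
  consequence of the equation \<open>\<phi> i j (c i x) = c j x\<close>.\<close>

lemma presents_direct_limit:
  fixes U :: "'i \<Rightarrow> 'a::comm_ring_1 set" and G :: "'i \<Rightarrow> 'b ring"
  assumes "I \<noteq> {}"
    and refl: "\<And>i. i \<in> I \<Longrightarrow> leq i i"
    and trans: "\<And>i j k. leq i j \<Longrightarrow> leq j k \<Longrightarrow> leq i k"
    and total: "\<And>i j. i \<in> I \<Longrightarrow> j \<in> I \<Longrightarrow> leq i j \<or> leq j i"
    and pres: "\<And>i. i \<in> I \<Longrightarrow> presents (U i) (c i) (G i)"
    and mono: "\<And>i j. i \<in> I \<Longrightarrow> j \<in> I \<Longrightarrow> leq i j \<Longrightarrow> U i \<subseteq> U j"
    and \<phi>: "\<And>i j x. i \<in> I \<Longrightarrow> j \<in> I \<Longrightarrow> leq i j \<Longrightarrow> x \<in> U i \<Longrightarrow> \<phi> i j (c i x) = c j x"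
  shows "\<exists>L. presents (\<Union>i\<in>I. U i) L (direct_limit I leq G \<phi>) \<and>
    (\<forall>x\<in>\<Union>i\<in>I. U i. \<forall>y\<in>\<Union>i\<in>I. U i.
      L x = L y \<longleftrightarrow> (\<exists>k\<in>I. x \<in> U k \<and> y \<in> U k \<and> c k x = c k y))"
proof -
  define r where "r = lim_rel I leq G \<phi>"
  define W where "W = (\<Union>i\<in>I. U i)"
  define L where "L x = (\<Union>i\<in>{i\<in>I. x \<in> U i}. r `` {(i, c i x)})" for x
  note D = presentsD[OF pres]
  note SU = subring_of_closed[OF D(1)]
  have dir: "\<exists>k\<in>I. leq i k \<and> leq j k" if "i \<in> I" "j \<in> I" for i j
    using that total refl by blast
  have carrier: "carrier (G i) = c i ` U i" if "i \<in> I" for i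
    using D(2) that by blast
  have persist: "c k x = c k y" if "i \<in> I" "k \<in> I" "leq i k" "x \<in> U i" "y \<in> U i" "c i x = c i y" for i k x y
    using \<phi>[OF that(1-4)] \<phi>[OF that(1-3,5)] that(6) by simp
  have r_iff: "((i, c i x), (j, c j y)) \<in> r \<longleftrightarrow> (\<exists>k\<in>I. x \<in> U k \<and> y \<in> U k \<and> c k x = c k y)"
    if ij: "i \<in> I" "j \<in> I" "x \<in> U i" "y \<in> U j" for i j x y
  proof
    assume "((i, c i x), (j, c j y)) \<in> r"
    then obtain k where k: "k \<in> I" "leq i k" "leq j k" "\<phi> i k (c i x) = \<phi> j k (c j y)"
      by (auto simp: r_def lim_rel_def)
    then show "\<exists>k\<in>I. x \<in> U k \<and> y \<in> U k \<and> c k x = c k y"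
      using ij \<phi>[OF ij(1) k(1,2) ij(3)] \<phi>[OF ij(2) k(1,3) ij(4)] mono by (metis subsetD)
  next
    assume "\<exists>k\<in>I. x \<in> U k \<and> y \<in> U k \<and> c k x = c k y"
    then obtain k where k: "k \<in> I" "x \<in> U k" "y \<in> U k" "c k x = c k y" by blast
    obtain l where l: "l \<in> I" "leq i l" "leq j l" using dir ij by blast
    obtain m where m: "m \<in> I" "leq k m" "leq l m" using dir k l by blast
    have "\<phi> i m (c i x) = \<phi> j m (c j y)"
      using \<phi>[OF ij(1) m(1) trans[OF l(2) m(3)] ij(3)]
        \<phi>[OF ij(2) m(1) trans[OF l(3) m(3)] ij(4)] persist[OF k(1) m(1,2) k(2-4)] by simp
    then show "((i, c i x), (j, c j y)) \<in> r"
      unfolding r_def lim_rel_def using ij m l trans by (auto simp: carrier)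
  qed
  have r_sub: "r \<subseteq> (SIGMA i:I. carrier (G i)) \<times> (SIGMA i:I. carrier (G i))"
    by (auto simp: r_def lim_rel_def)
  have equiv: "equiv (SIGMA i:I. carrier (G i)) r"
  proof (rule equivI)
    show "r \<subseteq> (SIGMA i:I. carrier (G i)) \<times> (SIGMA i:I. carrier (G i))" by (rule r_sub)
    show "refl_on (SIGMA i:I. carrier (G i)) r"
    proof (rule refl_onI)
      fix a assume "a \<in> (SIGMA i:I. carrier (G i))"
      then obtain i x where "i \<in> I" "x \<in> U i" "a = (i, c i x)" by (auto simp: carrier)
      then show "(a, a) \<in> r" using r_iff by blast
    qed
    show "sym r"
      unfolding sym_def r_def lim_rel_def by fastforce
    show "Relation.trans r"
    proof (rule transI)
      fix a b d assume ab: "(a, b) \<in> r" and bd: "(b, d) \<in> r"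
      then have "a \<in> (SIGMA i:I. carrier (G i))" "b \<in> (SIGMA i:I. carrier (G i))"
        "d \<in> (SIGMA i:I. carrier (G i))" using r_sub by blast+
      then obtain i x j y l z where *: "i \<in> I" "x \<in> U i" "a = (i, c i x)"
        "j \<in> I" "y \<in> U j" "b = (j, c j y)" "l \<in> I" "z \<in> U l" "d = (l, c l z)"
        by (auto simp: carrier)
      obtain m where m: "m \<in> I" "x \<in> U m" "y \<in> U m" "c m x = c m y"
        using ab * r_iff by auto
      obtain n where n: "n \<in> I" "y \<in> U n" "z \<in> U n" "c n y = c n z"
        using bd * r_iff by auto
      obtain k where k: "k \<in> I" "leq m k" "leq n k" using dir m n by blast
      have "c k x = c k z"
        using persist[OF m(1) k(1,2) m(2-4)] persist[OF n(1) k(1,3) n(2-4)] by simp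
      moreover have "x \<in> U k" "z \<in> U k" using mono m n k by blast+
      ultimately show "(a, d) \<in> r" using * k r_iff by auto
    qed
  qed
  have class_eq: "r `` {(i, c i x)} = r `` {(j, c j y)} \<longleftrightarrow> (\<exists>k\<in>I. x \<in> U k \<and> y \<in> U k \<and> c k x = c k y)"
    if "i \<in> I" "j \<in> I" "x \<in> U i" "y \<in> U j" for i j x y
    using eq_equiv_class_iff[OF equiv] that r_iff[OF that] by (auto simp: carrier)
  have L: "L x = r `` {(i, c i x)}" if "i \<in> I" "x \<in> U i" for i x
  proof -
    have "r `` {(j, c j x)} = r `` {(i, c i x)}" if "j \<in> I" "x \<in> U j" for j
      using class_eq that \<open>i \<in> I\<close> \<open>x \<in> U i\<close> by blast
    then show ?thesis unfolding L_def using that by blast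
  qed
  have L_iff: "L x = L y \<longleftrightarrow> (\<exists>k\<in>I. x \<in> U k \<and> y \<in> U k \<and> c k x = c k y)" if xy: "x \<in> W" "y \<in> W" for x y
  proof -
    obtain i j where ij: "i \<in> I" "x \<in> U i" "j \<in> I" "y \<in> U j" using xy by (auto simp: W_def)
    then show ?thesis using class_eq by (simp add: L)
  qed
  have both: "\<exists>k\<in>I. x \<in> U k \<and> y \<in> U k" if xy: "x \<in> W" "y \<in> W" for x y
  proof -
    obtain i j where ij: "i \<in> I" "x \<in> U i" "j \<in> I" "y \<in> U j" using xy by (auto simp: W_def)
    obtain k where "k \<in> I" "leq i k" "leq j k" using dir ij by blast
    then show ?thesis using ij mono by blast
  qed
  have "subring_of W"
  proof -
    have "x + y \<in> W \<and> x * y \<in> W" if xy: "x \<in> W" "y \<in> W" for x y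
      proof -
      obtain k where k: "k \<in> I" "x \<in> U k" "y \<in> U k" using both[OF xy] by blast
      then show ?thesis using SU(3,4)[OF k] unfolding W_def by blast
    qed
    moreover have "0 \<in> W" "1 \<in> W" using SU(1,2) \<open>I \<noteq> {}\<close> unfolding W_def by (metis UN_I ex_in_conv)+
    moreover have "- x \<in> W" if "x \<in> W" for x using that SU(5) unfolding W_def by blast
    ultimately show ?thesis by (auto simp: subring_of_def)
  qed
  have mem_L: "(i, a) \<in> L x \<longleftrightarrow> i \<in> I \<and> (\<exists>z\<in>U i. a = c i z \<and> (\<exists>k\<in>I. x \<in> U k \<and> z \<in> U k \<and> c k x = c k z))"
    if x: "x \<in> W" for x i a
  proof -
    obtain j where j: "j \<in> I" "x \<in> U j" using x by (auto simp: W_def)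
    have "(i, a) \<in> L x \<longleftrightarrow> ((j, c j x), (i, a)) \<in> r" using L[OF j] by simp
    also have "\<dots> \<longleftrightarrow> i \<in> I \<and> (\<exists>z\<in>U i. a = c i z \<and> (\<exists>k\<in>I. x \<in> U k \<and> z \<in> U k \<and> c k x = c k z))"
    proof
      assume h: "((j, c j x), (i, a)) \<in> r"
      then have "i \<in> I" "a \<in> c i ` U i" using r_sub carrier by blast+
      then show "i \<in> I \<and> (\<exists>z\<in>U i. a = c i z \<and> (\<exists>k\<in>I. x \<in> U k \<and> z \<in> U k \<and> c k x = c k z))"
        using h r_iff[OF j(1) _ j(2)] by blast
    next
      assume "i \<in> I \<and> (\<exists>z\<in>U i. a = c i z \<and> (\<exists>k\<in>I. x \<in> U k \<and> z \<in> U k \<and> c k x = c k z))"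
      then show "((j, c j x), (i, a)) \<in> r" using r_iff[OF j(1) _ j(2)] by blast
    qed
    finally show ?thesis .
  qed
  \<comment> \<open>All the classes united in the definition of an operation of the direct limit coincide: any two
    admissible choices of representatives agree at a late enough stage.\<close>
  have lift: "\<Union> {r `` {(k, opr (G k) (\<phi> i k a) (\<phi> j k b))} | i a j b k.
                 (i, a) \<in> L x \<and> (j, b) \<in> L y \<and> k \<in> I \<and> leq i k \<and> leq j k} = L (f x y)"
    if xy: "x \<in> W" "y \<in> W"
      and f: "\<And>i x y. i \<in> I \<Longrightarrow> x \<in> U i \<Longrightarrow> y \<in> U i \<Longrightarrow> f x y \<in> U i \<and> c i (f x y) = opr (G i) (c i x) (c i y)"
    for opr :: "'b ring \<Rightarrow> 'b \<Rightarrow> 'b \<Rightarrow> 'b" and f x y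
  proof -
    have one: "r `` {(k, opr (G k) (\<phi> i k a) (\<phi> j k b))} = L (f x y)"
      if h: "(i, a) \<in> L x" "(j, b) \<in> L y" "k \<in> I" "leq i k" "leq j k" for i a j b k
    proof -
      obtain x' m where x': "i \<in> I" "x' \<in> U i" "a = c i x'" "m \<in> I" "x \<in> U m" "x' \<in> U m" "c m x = c m x'"
        using h(1) mem_L[OF xy(1)] by auto
      obtain y' n where y': "j \<in> I" "y' \<in> U j" "b = c j y'" "n \<in> I" "y \<in> U n" "y' \<in> U n" "c n y = c n y'"
        using h(2) mem_L[OF xy(2)] by auto
      obtain p where p: "p \<in> I" "leq m p" "leq n p" using dir x' y' by blast
      have k: "x' \<in> U k" "y' \<in> U k" using mono h x' y' by blast+
      have up: "x \<in> U p" "x' \<in> U p" "y \<in> U p" "y' \<in> U p" using mono p x' y' by blast+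
      have "c p x = c p x'" "c p y = c p y'"
        using persist[OF x'(4) p(1,2) x'(5,6,7)] persist[OF y'(4) p(1,3) y'(5,6,7)] by auto
      then have eq: "c p (f x y) = c p (f x' y')" using f p(1) up by simp
      have "r `` {(k, opr (G k) (\<phi> i k a) (\<phi> j k b))} = r `` {(k, c k (f x' y'))}"
        using f[OF h(3) k] \<phi>[OF x'(1) h(3,4) x'(2)] \<phi>[OF y'(1) h(3,5) y'(2)] x'(3) y'(3) by simp
      also have "\<dots> = L (f x' y')" using L h(3) f[OF h(3) k] by simp
      also have "\<dots> = L (f x y)"
      proof -
        have "f x y \<in> U p" "f x' y' \<in> U p" using f p(1) up by blast+
        then show ?thesis using L_iff[of "f x y" "f x' y'"] eq p(1) unfolding W_def by blast
      qed
      finally show ?thesis .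
    qed
    obtain k where k: "k \<in> I" "x \<in> U k" "y \<in> U k" using both[OF xy] by blast
    then have "(k, c k x) \<in> L x" "(k, c k y) \<in> L y" using mem_L xy by blast+
    then have "r `` {(k, opr (G k) (\<phi> k k (c k x)) (\<phi> k k (c k y)))} \<in> {r `` {(k, opr (G k) (\<phi> i k a) (\<phi> j k b))} | i a j b k.
                 (i, a) \<in> L x \<and> (j, b) \<in> L y \<and> k \<in> I \<and> leq i k \<and> leq j k}"
      using k refl by blast
    with one show ?thesis by blast
  qed
  have "presents W L (direct_limit I leq G \<phi>)"
    unfolding presents_def
  proof (intro conjI ballI)
    show "subring_of W" by fact
    show "L ` W = carrier (direct_limit I leq G \<phi>)"
      unfolding direct_limit_def Let_def r_def[symmetric]
    proof (simp add: quotient_def, intro equalityI subsetI)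
      fix X assume "X \<in> L ` W"
      then obtain i x where "i \<in> I" "x \<in> U i" "X = r `` {(i, c i x)}" using L unfolding W_def by blast
      then show "X \<in> (\<Union>p\<in>(SIGMA i:I. carrier (G i)). {r `` {p}})" using carrier by blast
    next
      fix X assume "X \<in> (\<Union>p\<in>(SIGMA i:I. carrier (G i)). {r `` {p}})"
      then obtain i x where "i \<in> I" "x \<in> U i" "X = r `` {(i, c i x)}" by (auto simp: carrier)
      then show "X \<in> L ` W" using L unfolding W_def by blast
    qed
    show "L 0 = \<zero>\<^bsub>direct_limit I leq G \<phi>\<^esub>" "L 1 = \<one>\<^bsub>direct_limit I leq G \<phi>\<^esub>"
      unfolding direct_limit_def Let_def r_def[symmetric] L_def using SU(1,2) D(3,4) by auto
    fix x y assume xy: "x \<in> W" "y \<in> W"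
    show "L (x + y) = L x \<oplus>\<^bsub>direct_limit I leq G \<phi>\<^esub> L y"
      using lift[OF xy, of "(+)" add] SU(3) D(5)
      unfolding direct_limit_def Let_def r_def[symmetric] by simp
    show "L (x * y) = L x \<otimes>\<^bsub>direct_limit I leq G \<phi>\<^esub> L y"
      using lift[OF xy, of "(*)" monoid.mult] SU(4) D(6)
      unfolding direct_limit_def Let_def r_def[symmetric] by simp
  qed
  then show ?thesis using L_iff unfolding W_def by blast
qed

section \<open>Values\<close>

lemma Fin_le_Fin [simp]: "Fin a \<le> Fin b \<longleftrightarrow> a \<le> b"
  by (simp add: less_eq_with_inf_def)

lemma Fin_less_Fin [simp]: "Fin a < Fin b \<longleftrightarrow> a < b"
  by (simp add: less_with_inf_def)

lemma le_Infty [simp]: "(a :: 'g::linorder with_inf) \<le> Infty"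
  by (simp add: less_eq_with_inf_def)

lemma Fin_less_Infty [simp]: "Fin a < Infty"
  by (simp add: less_with_inf_def)

lemma Infty_le_iff [simp]: "Infty \<le> (a :: 'g::linorder with_inf) \<longleftrightarrow> a = Infty"
  by (simp add: less_eq_with_inf_def split: with_inf.splits)

lemma not_Infty_less [simp]: "\<not> Infty < (a :: 'g::linorder with_inf)"
  by (simp add: less_with_inf_def)

lemma plus_with_inf_simps [simp]:
  "Fin a + Fin b = Fin (a + b)" "Infty + x = Infty" "x + Infty = Infty"
  by (auto simp: plus_with_inf_def split: with_inf.splits)

lemma with_inf_add_mono:
  fixes a b c d :: "'g::linordered_ab_group_add with_inf"
  shows "a \<le> b \<Longrightarrow> c \<le> d \<Longrightarrow> a + c \<le> b + d"
  by (cases a; cases b; cases c; cases d) (auto intro: add_mono)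

lemma with_inf_add_le_le:
  fixes b d :: "'g::linordered_ab_group_add with_inf"
  shows "Fin x \<le> b \<Longrightarrow> Fin y \<le> d \<Longrightarrow> Fin (x + y) \<le> b + d"
  using with_inf_add_mono[of "Fin x" b "Fin y" d] by simp

lemma with_inf_add_less_le:
  fixes a b c d :: "'g::linordered_ab_group_add with_inf"
  shows "Fin x < b \<Longrightarrow> Fin y \<le> d \<Longrightarrow> Fin (x + y) < b + d"
  by (cases b; cases d) (auto intro: add_less_le_mono)

lemma with_inf_add_le_less:
  fixes a b c d :: "'g::linordered_ab_group_add with_inf"
  shows "Fin x \<le> b \<Longrightarrow> Fin y < d \<Longrightarrow> Fin (x + y) < b + d"
  by (cases b; cases d) (auto intro: add_le_less_mono)

lemma valuationD:
  assumes "valuation \<nu>"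
  shows "\<nu> (a * b) = \<nu> a + \<nu> b" "min (\<nu> a) (\<nu> b) \<le> \<nu> (a + b)" "\<nu> 1 = Fin 0" "\<nu> 0 = Infty"
  using assms by (auto simp: valuation_def zero_with_inf_def)

lemma valuation_add_ge:
  "valuation \<nu> \<Longrightarrow> x \<le> \<nu> a \<Longrightarrow> x \<le> \<nu> b \<Longrightarrow> x \<le> \<nu> (a + b)"
  using valuationD(2)[of \<nu> a b] by (auto simp: min_def split: if_splits)

lemma valuation_add_gt:
  "valuation \<nu> \<Longrightarrow> x < \<nu> a \<Longrightarrow> x < \<nu> b \<Longrightarrow> x < \<nu> (a + b)"
  using valuationD(2)[of \<nu> a b] by (auto simp: min_def split: if_splits)

lemma valuation_uminus:
  fixes \<nu> :: "'a::comm_ring_1 \<Rightarrow> 'g::linordered_ab_group_add with_inf"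
  assumes "valuation \<nu>"
  shows "\<nu> (- a) = \<nu> a"
proof -
  have "\<nu> (- 1) + \<nu> (- 1) = Fin 0"
    using valuationD(1)[OF assms, of "- 1" "- 1"] valuationD(3)[OF assms] by simp
  then have "\<nu> (- 1) = Fin 0"
    by (cases "\<nu> (- 1)") (auto simp: double_zero)
  then show ?thesis
    using valuationD(1)[OF assms, of "- 1" a] by (cases "\<nu> a") auto
qed

lemma valuation_diff_ge:
  "valuation \<nu> \<Longrightarrow> x \<le> \<nu> a \<Longrightarrow> x \<le> \<nu> b \<Longrightarrow> x \<le> \<nu> (a - b)"
  using valuation_add_ge[of \<nu> x a "- b"] by (simp add: valuation_uminus)

lemma valuation_diff_gt:
  "valuation \<nu> \<Longrightarrow> x < \<nu> a \<Longrightarrow> x < \<nu> b \<Longrightarrow> x < \<nu> (a - b)"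
  using valuation_add_gt[of \<nu> x a "- b"] by (simp add: valuation_uminus)

lemma valuation_sum_ge:
  assumes "valuation \<nu>" "\<And>i. i \<in> A \<Longrightarrow> x \<le> \<nu> (h i)"
  shows "x \<le> \<nu> (sum h A)"
  using assms(2)
  by (induction A rule: infinite_finite_induct)
    (auto simp: valuationD(4)[OF assms(1)] intro: valuation_add_ge[OF assms(1)])

lemma valuation_sum_gt:
  assumes "valuation \<nu>" "x < Infty" "\<And>i. i \<in> A \<Longrightarrow> x < \<nu> (h i)"
  shows "x < \<nu> (sum h A)"
  using assms(3)
  by (induction A rule: infinite_finite_induct)
    (auto simp: valuationD(4)[OF assms(1)] assms(2) intro: valuation_add_gt[OF assms(1)])

lemma valuation_add_dominated:
  assumes "valuation \<nu>" "\<nu> a < \<nu> b"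
  shows "\<nu> (a + b) = \<nu> a"
proof (rule antisym)
  show "\<nu> (a + b) \<le> \<nu> a"
  proof (rule ccontr)
    assume "\<not> \<nu> (a + b) \<le> \<nu> a"
    then have "\<nu> a < \<nu> (a + b - b)"
      using assms by (intro valuation_diff_gt[OF assms(1)]) auto
    then show False by simp
  qed
  show "\<nu> a \<le> \<nu> (a + b)"
    using assms by (intro valuation_add_ge[OF assms(1)]) auto
qed

section \<open>The Rees algebra\<close>

abbreviation lookup :: "('a \<Rightarrow>\<^sub>0 'b::zero) \<Rightarrow> 'a \<Rightarrow> 'b" where
  "lookup \<equiv> Poly_Mapping.lookup"

abbreviation keys :: "('a \<Rightarrow>\<^sub>0 'b::zero) \<Rightarrow> 'a set" where
  "keys \<equiv> Poly_Mapping.keys"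

text \<open>The Rees algebra of the filtration of \<open>\<nu>\<close>, inside the monoid algebra of the value group over the
  polynomials: a family places in degree \<open>\<delta>\<close> a polynomial of value at least \<open>\<delta>\<close>. Unlike the graded
  rings themselves, these algebras for \<open>\<nu> \<le> \<mu>\<close> are contained in each other.\<close>

definition rees ::
    "('k::field poly \<Rightarrow> 'g::linordered_ab_group_add with_inf) \<Rightarrow> ('g \<Rightarrow>\<^sub>0 'k poly) set" where
  "rees \<nu> = {F. \<forall>\<delta>. Fin \<delta> \<le> \<nu> (lookup F \<delta>)}"

definition graded_class ::
    "('k::field poly \<Rightarrow> 'g::linordered_ab_group_add with_inf) \<Rightarrow> ('g \<Rightarrow>\<^sub>0 'k poly)
      \<Rightarrow> ('g \<Rightarrow> 'k poly set)" where
  "graded_class \<nu> F = (\<lambda>\<delta>\<in>value_set \<nu>. pcoset \<nu> \<delta> (lookup F \<delta>))"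

lemma in_value_set_iff: "\<delta> \<in> value_set \<nu> \<longleftrightarrow> (\<exists>f. \<nu> f = Fin \<delta>)"
  by (simp add: value_set_def val_support_def) (metis with_inf.distinct(1))

lemma mem_pcoset: "g \<in> pcoset \<nu> \<delta> f \<longleftrightarrow> Fin \<delta> < \<nu> (g - f)"
  by (auto simp: pcoset_def r_coset_def P_group_def P_gt_def algebra_simps
      intro!: bexI[of _ "g - f"])

lemma pcoset_eq_iff:
  assumes "valuation \<nu>"
  shows "pcoset \<nu> \<delta> f = pcoset \<nu> \<delta> g \<longleftrightarrow> Fin \<delta> < \<nu> (f - g)"
proof
  assume "pcoset \<nu> \<delta> f = pcoset \<nu> \<delta> g"
  moreover have "f \<in> pcoset \<nu> \<delta> f" by (simp add: mem_pcoset valuationD(4)[OF assms])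
  ultimately show "Fin \<delta> < \<nu> (f - g)" by (simp add: mem_pcoset)
next
  assume fg: "Fin \<delta> < \<nu> (f - g)"
  show "pcoset \<nu> \<delta> f = pcoset \<nu> \<delta> g"
  proof (intro Set.set_eqI)
    fix h
    have "Fin \<delta> < \<nu> (h - f) \<Longrightarrow> Fin \<delta> < \<nu> ((h - f) + (f - g))"
      "Fin \<delta> < \<nu> (h - g) \<Longrightarrow> Fin \<delta> < \<nu> ((h - g) - (f - g))"
      using fg assms valuation_add_gt valuation_diff_gt by blast+
    then show "h \<in> pcoset \<nu> \<delta> f \<longleftrightarrow> h \<in> pcoset \<nu> \<delta> g" by (auto simp: mem_pcoset)
  qed
qed

lemma piece_simps:
  shows "carrier (piece \<nu> \<delta>) = pcoset \<nu> \<delta> ` P_ge \<nu> \<delta>" "\<one>\<^bsub>piece \<nu> \<delta>\<^esub> = pcoset \<nu> \<delta> 0"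
  by (auto simp: piece_def FactGroup_def RCOSETS_def pcoset_def P_group_def r_coset_def)

lemma piece_mult:
  assumes "valuation \<nu>"
  shows "pcoset \<nu> \<delta> f \<otimes>\<^bsub>piece \<nu> \<delta>\<^esub> pcoset \<nu> \<delta> g = pcoset \<nu> \<delta> (f + g)"
proof (intro Set.set_eqI iffI)
  fix h assume "h \<in> pcoset \<nu> \<delta> f \<otimes>\<^bsub>piece \<nu> \<delta>\<^esub> pcoset \<nu> \<delta> g"
  then obtain a b where "h = a + b" "a \<in> pcoset \<nu> \<delta> f" "b \<in> pcoset \<nu> \<delta> g"
    by (auto simp: piece_def FactGroup_def set_mult_def P_group_def)
  then show "h \<in> pcoset \<nu> \<delta> (f + g)"
    using valuation_add_gt[OF assms, of "Fin \<delta>" "a - f" "b - g"]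
    by (simp add: mem_pcoset algebra_simps)
next
  fix h assume "h \<in> pcoset \<nu> \<delta> (f + g)"
  then have "h - g \<in> pcoset \<nu> \<delta> f" "g \<in> pcoset \<nu> \<delta> g"
    by (auto simp: mem_pcoset algebra_simps valuationD(4)[OF assms])
  then show "h \<in> pcoset \<nu> \<delta> f \<otimes>\<^bsub>piece \<nu> \<delta>\<^esub> pcoset \<nu> \<delta> g"
    by (force simp: piece_def FactGroup_def set_mult_def P_group_def)
qed

lemma piece_comm_group:
  assumes "valuation \<nu>"
  shows "comm_group (piece \<nu> \<delta>)"
proof (rule comm_groupI)
  fix A assume "A \<in> carrier (piece \<nu> \<delta>)"
  then obtain f where f: "f \<in> P_ge \<nu> \<delta>" "A = pcoset \<nu> \<delta> f" by (auto simp: piece_simps)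
  then show "\<exists>B\<in>carrier (piece \<nu> \<delta>). B \<otimes>\<^bsub>piece \<nu> \<delta>\<^esub> A = \<one>\<^bsub>piece \<nu> \<delta>\<^esub>"
    by (intro bexI[of _ "pcoset \<nu> \<delta> (- f)"])
      (auto simp: piece_simps piece_mult[OF assms] P_ge_def valuation_uminus[OF assms])
qed (auto simp: piece_simps piece_mult[OF assms] ac_simps P_ge_def valuationD(4)[OF assms]
       intro!: imageI valuation_add_ge[OF assms])

lemma finprod_piece:
  assumes "valuation \<nu>" "finite A" "\<And>i. i \<in> A \<Longrightarrow> Fin \<delta> \<le> \<nu> (h i)"
  shows "finprod (piece \<nu> \<delta>) (\<lambda>i. pcoset \<nu> \<delta> (h i)) A = pcoset \<nu> \<delta> (sum h A)"
proof -
  interpret comm_group "piece \<nu> \<delta>" by (rule piece_comm_group[OF assms(1)])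
  show ?thesis
    using assms(2,3)
    by (induction A rule: finite_induct)
      (auto simp: piece_simps piece_mult[OF assms(1)] P_ge_def Pi_iff)
qed

text \<open>A finitely supported family of classes lifts to a finitely supported family of polynomials, by
  choosing a representative of each non-zero class and \<open>0\<close> for the others.\<close>

lemma carrier_graded_group:
  assumes "valuation \<nu>"
  shows "carrier (graded_group \<nu>) = graded_class \<nu> ` rees \<nu>"
proof -
  have c: "carrier (graded_group \<nu>) = {s \<in> \<Pi>\<^sub>E \<delta>\<in>value_set \<nu>. carrier (piece \<nu> \<delta>). finite (gsupp \<nu> s)}"
    unfolding graded_group_def gsupp_def
    by (rule carrier_sum_group) (rule comm_group.axioms(2)[OF piece_comm_group[OF assms]])
  show ?thesis
  proof (intro equalityI subsetI)
    fix s assume "s \<in> carrier (graded_group \<nu>)"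
    then have s: "s \<in> (\<Pi>\<^sub>E \<delta>\<in>value_set \<nu>. pcoset \<nu> \<delta> ` P_ge \<nu> \<delta>)" "finite (gsupp \<nu> s)"
      by (auto simp: c piece_simps)
    define rep where "rep \<delta> = (if \<delta> \<in> gsupp \<nu> s then (SOME f. f \<in> P_ge \<nu> \<delta> \<and> s \<delta> = pcoset \<nu> \<delta> f) else 0)" for \<delta>
    have "\<exists>f. f \<in> P_ge \<nu> \<delta> \<and> s \<delta> = pcoset \<nu> \<delta> f" if "\<delta> \<in> gsupp \<nu> s" for \<delta>
      using s(1) that by (auto simp: gsupp_def PiE_iff)
    then have rep: "rep \<delta> \<in> P_ge \<nu> \<delta> \<and> s \<delta> = pcoset \<nu> \<delta> (rep \<delta>)" if "\<delta> \<in> gsupp \<nu> s" for \<delta>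
      using someI_ex[of "\<lambda>f. f \<in> P_ge \<nu> \<delta> \<and> s \<delta> = pcoset \<nu> \<delta> f"] that by (simp add: rep_def)
    define F where "F = Abs_poly_mapping rep"
    have "{\<delta>. rep \<delta> \<noteq> 0} \<subseteq> gsupp \<nu> s" by (auto simp: rep_def)
    then have F: "lookup F = rep"
      unfolding F_def using s(2) by (intro lookup_Abs_poly_mapping) (rule finite_subset)
    have "Fin \<delta> \<le> \<nu> (rep \<delta>)" for \<delta>
      using rep[of \<delta>] by (cases "\<delta> \<in> gsupp \<nu> s") (auto simp: P_ge_def rep_def valuationD(4)[OF assms])
    then have "F \<in> rees \<nu>" by (simp add: rees_def F)
    moreover have "s = graded_class \<nu> F"
    proof
      fix \<delta> show "s \<delta> = graded_class \<nu> F \<delta>"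
        using s(1) rep[of \<delta>] 
        by (auto simp: graded_class_def F PiE_iff extensional_def gsupp_def piece_simps rep_def)
    qed
    ultimately show "s \<in> graded_class \<nu> ` rees \<nu>" by blast
  next
    fix s assume "s \<in> graded_class \<nu> ` rees \<nu>"
    then obtain F where F: "F \<in> rees \<nu>" "s = graded_class \<nu> F" by blast
    have "gsupp \<nu> s \<subseteq> keys F"
      by (auto simp: gsupp_def F graded_class_def piece_simps in_keys_iff)
    then show "s \<in> carrier (graded_group \<nu>)"
      using F by (auto simp: c piece_simps graded_class_def rees_def P_ge_def finite_subset)
  qed
qed

text \<open>Outside \<open>value_set \<nu>\<close> the inequality on the right is automatic, because \<open>\<nu>\<close> never takes the
  value \<open>\<delta>\<close> there. Quantifying over all \<open>\<delta>\<close> removes \<open>\<nu>\<close> from the range of the quantifier, so that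
  the condition can be compared for different valuations.\<close>

lemma graded_class_eq_iff:
  assumes "valuation \<nu>" "F \<in> rees \<nu>" "G \<in> rees \<nu>"
  shows "graded_class \<nu> F = graded_class \<nu> G \<longleftrightarrow> (\<forall>\<delta>. Fin \<delta> < \<nu> (lookup F \<delta> - lookup G \<delta>))"
proof -
  have "graded_class \<nu> F = graded_class \<nu> G \<longleftrightarrow>
      (\<forall>\<delta>\<in>value_set \<nu>. pcoset \<nu> \<delta> (lookup F \<delta>) = pcoset \<nu> \<delta> (lookup G \<delta>))"
    by (auto simp: graded_class_def restrict_def fun_eq_iff)
  also have "\<dots> \<longleftrightarrow> (\<forall>\<delta>\<in>value_set \<nu>. Fin \<delta> < \<nu> (lookup F \<delta> - lookup G \<delta>))"
    by (simp add: pcoset_eq_iff[OF assms(1)])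
  also have "\<dots> \<longleftrightarrow> (\<forall>\<delta>. Fin \<delta> < \<nu> (lookup F \<delta> - lookup G \<delta>))"
  proof -
    have "Fin \<delta> < \<nu> (lookup F \<delta> - lookup G \<delta>)" if "\<delta> \<notin> value_set \<nu>" for \<delta>
    proof -
      have "Fin \<delta> \<le> \<nu> (lookup F \<delta> - lookup G \<delta>)"
        using assms by (intro valuation_diff_ge[OF assms(1)]) (auto simp: rees_def)
      moreover have "\<nu> (lookup F \<delta> - lookup G \<delta>) \<noteq> Fin \<delta>"
        using that by (auto simp: in_value_set_iff)
      ultimately show ?thesis by simp
    qed
    then show ?thesis by blast
  qed
  finally show ?thesis .
qed

lemma lookup_times_superset:
  fixes F G :: "'g::comm_monoid_add \<Rightarrow>\<^sub>0 'b::comm_ring_1"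
  shows "lookup (F * G) \<delta> = (\<Sum>(\<alpha>, \<beta>) | \<alpha> \<in> keys F \<and> \<beta> \<in> keys G \<and> \<alpha> + \<beta> = \<delta>. lookup F \<alpha> * lookup G \<beta>)"
proof -
  have fin: "finite (keys F \<times> keys G)" by simp
  have "lookup (F * G) \<delta> = (\<Sum>(\<alpha>, \<beta>). lookup F \<alpha> * lookup G \<beta> when \<delta> = \<alpha> + \<beta>)"
    unfolding times_poly_mapping.rep_eq by (rule prod_fun_unfold_prod) auto
  also have "\<dots> = (\<Sum>(\<alpha>, \<beta>)\<in>keys F \<times> keys G. lookup F \<alpha> * lookup G \<beta> when \<delta> = \<alpha> + \<beta>)"
    by (rule Sum_any.expand_superset[OF fin]) (auto simp: in_keys_iff)
  also have "\<dots> = (\<Sum>(\<alpha>, \<beta>) | \<alpha> \<in> keys F \<and> \<beta> \<in> keys G \<and> \<alpha> + \<beta> = \<delta>. lookup F \<alpha> * lookup G \<beta>)"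
    by (rule sum.mono_neutral_cong_right[OF fin]) auto
  finally show ?thesis .
qed

lemma subring_of_rees:
  assumes "valuation \<nu>"
  shows "subring_of (rees \<nu>)"
proof -
  have "Fin \<delta> \<le> \<nu> (lookup (F * G) \<delta>)" if "F \<in> rees \<nu>" "G \<in> rees \<nu>" for F G \<delta>
    unfolding lookup_times_superset
    using that
    by (intro valuation_sum_ge[OF assms])
      (auto simp: valuationD(1)[OF assms] rees_def intro!: with_inf_add_le_le)
  then show ?thesis
    unfolding subring_of_def
    by (auto simp: rees_def lookup_add lookup_one when_def valuationD[OF assms] valuation_uminus[OF assms]
        intro!: valuation_add_ge[OF assms])
qed

lemma pmult_pcoset:
  assumes "valuation \<nu>" "Fin \<alpha> \<le> \<nu> f" "Fin \<beta> \<le> \<nu> g"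
  shows "pmult \<nu> \<alpha> \<beta> (pcoset \<nu> \<alpha> f) (pcoset \<nu> \<beta> g) = pcoset \<nu> (\<alpha> + \<beta>) (f * g)"
proof -
  have "pcoset \<nu> (\<alpha> + \<beta>) (f' * g') = pcoset \<nu> (\<alpha> + \<beta>) (f * g)"
    if "f' \<in> pcoset \<nu> \<alpha> f" "g' \<in> pcoset \<nu> \<beta> g" for f' g'
  proof -
    have "Fin \<alpha> < \<nu> (f' - f)" "Fin \<beta> < \<nu> (g' - g)" using that by (auto simp: mem_pcoset)
    moreover from this have "Fin \<beta> \<le> \<nu> (g + (g' - g))"
      using assms by (intro valuation_add_ge[OF assms(1)]) auto
    ultimately have "Fin (\<alpha> + \<beta>) < \<nu> ((f' - f) * g' + f * (g' - g))"
      using assms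
      by (intro valuation_add_gt[OF assms(1)]) (auto simp: valuationD(1) intro: with_inf_add_less_le with_inf_add_le_less)
    then show ?thesis
      by (simp add: pcoset_eq_iff[OF assms(1)] algebra_simps)
  qed
  moreover have "f \<in> pcoset \<nu> \<alpha> f" "g \<in> pcoset \<nu> \<beta> g"
    by (auto simp: mem_pcoset valuationD(4)[OF assms(1)])
  ultimately show ?thesis unfolding pmult_def by blast
qed

lemma gsupp_graded_class:
  assumes "valuation \<nu>" "F \<in> rees \<nu>"
  shows "gsupp \<nu> (graded_class \<nu> F) = {\<delta>. \<nu> (lookup F \<delta>) = Fin \<delta>}"
  using assms(2)
  by (auto simp: gsupp_def graded_class_def piece_simps pcoset_eq_iff[OF assms(1)] rees_def in_value_set_iff
      not_less order.antisym)

lemma gsupp_subset_keys: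
  assumes "valuation \<nu>" "F \<in> rees \<nu>"
  shows "gsupp \<nu> (graded_class \<nu> F) \<subseteq> keys F"
  using valuationD(4)[OF assms(1)] by (auto simp: gsupp_graded_class[OF assms] in_keys_iff)

text \<open>The graded product sums only over the degrees where both factors are non-zero, while the
  convolution product sums over all degrees present in the two families. The extra products have
  value larger than \<open>\<delta>\<close>, since one of their factors has value larger than its degree.\<close>

lemma graded_class_mult:
  assumes "valuation \<nu>" "F \<in> rees \<nu>" "G \<in> rees \<nu>"
  shows "graded_class \<nu> (F * G) = graded_mult \<nu> (graded_class \<nu> F) (graded_class \<nu> G)"
proof
  fix \<delta>
  define S where "S = {(\<alpha>, \<beta>). \<alpha> \<in> gsupp \<nu> (graded_class \<nu> F) \<and> \<beta> \<in> gsupp \<nu> (graded_class \<nu> G) \<and> \<alpha> + \<beta> = \<delta>}"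
  define T where "T = {(\<alpha>, \<beta>). \<alpha> \<in> keys F \<and> \<beta> \<in> keys G \<and> \<alpha> + \<beta> = \<delta>}"
  have ge: "Fin \<alpha> \<le> \<nu> (lookup F \<alpha>)" "Fin \<alpha> \<le> \<nu> (lookup G \<alpha>)" for \<alpha>
    using assms by (auto simp: rees_def)
  have finT: "finite T"
    by (rule finite_subset[of _ "keys F \<times> keys G"]) (auto simp: T_def)
  have ST: "S \<subseteq> T" using gsupp_subset_keys assms unfolding S_def T_def by blast
  interpret comm_group "piece \<nu> \<delta>" by (rule piece_comm_group[OF assms(1)])
  have Fin_mult: "Fin \<delta> \<le> \<nu> (lookup F \<alpha> * lookup G \<beta>)" if "\<alpha> + \<beta> = \<delta>" for \<alpha> \<beta>
    using with_inf_add_le_le[OF ge] that by (force simp: valuationD(1)[OF assms(1)])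
  have "finprod (piece \<nu> \<delta>) (\<lambda>(\<alpha>, \<beta>). pmult \<nu> \<alpha> \<beta> (graded_class \<nu> F \<alpha>) (graded_class \<nu> G \<beta>)) S
      = finprod (piece \<nu> \<delta>) (\<lambda>p. pcoset \<nu> \<delta> (case p of (\<alpha>, \<beta>) \<Rightarrow> lookup F \<alpha> * lookup G \<beta>)) S"
    by (rule finprod_cong')
      (use ge Fin_mult in \<open>auto simp: S_def gsupp_def graded_class_def pmult_pcoset[OF assms(1)] piece_simps P_ge_def\<close>)
  also have "\<dots> = pcoset \<nu> \<delta> (\<Sum>(\<alpha>, \<beta>)\<in>S. lookup F \<alpha> * lookup G \<beta>)"
    using finT ST Fin_mult by (intro finprod_piece[OF assms(1)]) (auto simp: finite_subset S_def)
  also have "\<dots> = pcoset \<nu> \<delta> (\<Sum>(\<alpha>, \<beta>)\<in>T. lookup F \<alpha> * lookup G \<beta>)"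
  proof -
    have "Fin \<delta> < \<nu> (lookup F \<alpha> * lookup G \<beta>)" if "(\<alpha>, \<beta>) \<in> T - S" for \<alpha> \<beta>
    proof -
      have "\<nu> (lookup F \<alpha>) \<noteq> Fin \<alpha> \<or> \<nu> (lookup G \<beta>) \<noteq> Fin \<beta>" "\<alpha> + \<beta> = \<delta>"
        using that by (auto simp: T_def S_def gsupp_graded_class assms)
      then have "Fin \<alpha> < \<nu> (lookup F \<alpha>) \<or> Fin \<beta> < \<nu> (lookup G \<beta>)"
        using ge by (metis order.not_eq_order_implies_strict)
      with ge \<open>\<alpha> + \<beta> = \<delta>\<close> show ?thesis
        by (auto simp: valuationD(1)[OF assms(1)] intro: with_inf_add_less_le with_inf_add_le_less)
    qed
    then have "Fin \<delta> < \<nu> (\<Sum>(\<alpha>, \<beta>)\<in>T - S. lookup F \<alpha> * lookup G \<beta>)"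
      by (intro valuation_sum_gt[OF assms(1)]) auto
    moreover have "(\<Sum>(\<alpha>, \<beta>)\<in>T. lookup F \<alpha> * lookup G \<beta>) =
       (\<Sum>(\<alpha>, \<beta>)\<in>T - S. lookup F \<alpha> * lookup G \<beta>) + (\<Sum>(\<alpha>, \<beta>)\<in>S. lookup F \<alpha> * lookup G \<beta>)"
      by (rule sum.subset_diff[OF ST finT])
    ultimately show ?thesis
      using valuation_uminus[OF assms(1)] by (simp add: pcoset_eq_iff[OF assms(1)])
  qed
  also have "\<dots> = pcoset \<nu> \<delta> (lookup (F * G) \<delta>)"
    unfolding T_def lookup_times_superset ..
  finally show "graded_class \<nu> (F * G) \<delta> = graded_mult \<nu> (graded_class \<nu> F) (graded_class \<nu> G) \<delta>"
    by (simp add: graded_class_def graded_mult_def S_def restrict_def)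
qed

lemma graded_class_single:
  assumes "valuation \<nu>" "Fin \<delta> \<le> \<nu> f"
  shows "graded_class \<nu> (Poly_Mapping.single \<delta> f) =
    (if \<nu> f = Fin \<delta> then initial \<nu> f else \<one>\<^bsub>graded_group \<nu>\<^esub>)"
proof
  fix \<epsilon>
  show "graded_class \<nu> (Poly_Mapping.single \<delta> f) \<epsilon> =
    (if \<nu> f = Fin \<delta> then initial \<nu> f else \<one>\<^bsub>graded_group \<nu>\<^esub>) \<epsilon>"
    using assms(2)
    by (auto simp: graded_class_def initial_def graded_group_def piece_simps lookup_single when_def
        restrict_def pcoset_eq_iff[OF assms(1)] valuationD(4)[OF assms(1)] order.not_eq_order_implies_strict)
qed

lemma presents_graded_ring:
  assumes "valuation \<nu>"
  shows "presents (rees \<nu>) (graded_class \<nu>) (graded_ring \<nu>)"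
  unfolding presents_def
proof (intro conjI ballI)
  show "subring_of (rees \<nu>)" by (rule subring_of_rees[OF assms])
  show "graded_class \<nu> ` rees \<nu> = carrier (graded_ring \<nu>)"
    by (simp add: graded_ring_def carrier_graded_group[OF assms])
  show "graded_class \<nu> 0 = \<zero>\<^bsub>graded_ring \<nu>\<^esub>"
    by (simp add: graded_ring_def graded_class_def graded_group_def piece_simps)
  show "graded_class \<nu> 1 = \<one>\<^bsub>graded_ring \<nu>\<^esub>"
    using graded_class_single[OF assms, of 0 1]
    by (simp add: graded_ring_def valuationD(3)[OF assms])
  fix F G assume FG: "F \<in> rees \<nu>" "G \<in> rees \<nu>"
  show "graded_class \<nu> (F + G) = graded_class \<nu> F \<oplus>\<^bsub>graded_ring \<nu>\<^esub> graded_class \<nu> G"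
    by (auto simp: graded_ring_def graded_class_def graded_group_def lookup_add piece_mult[OF assms] restrict_def fun_eq_iff)
  show "graded_class \<nu> (F * G) = graded_class \<nu> F \<otimes>\<^bsub>graded_ring \<nu>\<^esub> graded_class \<nu> G"
    using graded_class_mult[OF assms FG] by (simp add: graded_ring_def)
qed

lemma rees_mono: "\<nu> \<le> \<mu> \<Longrightarrow> rees \<nu> \<subseteq> rees \<mu>"
  by (auto simp: rees_def le_fun_def intro: order_trans)

text \<open>In terms of Rees algebras the transition map is induced by the inclusion \<open>rees \<nu> \<subseteq> rees \<mu>\<close>. Indeed
  a polynomial \<open>f\<close> of \<open>\<nu>\<close>-value \<open>\<delta>\<close> has, in degree \<open>\<delta>\<close>, the class \<open>initial \<mu> f\<close> if its \<open>\<mu>\<close>-value is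
  also \<open>\<delta>\<close>, and the class \<open>0\<close> if that value is larger.\<close>

lemma graded_map_graded_class:
  assumes "valuation \<nu>" "valuation \<mu>" "\<nu> \<le> \<mu>" "F \<in> rees \<nu>"
  shows "graded_map \<nu> \<mu> (graded_class \<nu> F) = graded_class \<mu> F"
proof -
  define S where "S = gsupp \<nu> (graded_class \<nu> F)"
  define rep where "rep \<delta> = (SOME f. f \<in> graded_class \<nu> F \<delta>)" for \<delta>
  have le: "\<nu> f \<le> \<mu> f" for f using assms(3) by (simp add: le_fun_def)
  note P = presents_graded_ring[OF assms(2)]
  have finS: "finite S"
    using gsupp_subset_keys[OF assms(1,4)] unfolding S_def by (rule finite_subset) simp
  have repd: "Fin \<delta> < \<nu> (rep \<delta> - lookup F \<delta>)" if "\<delta> \<in> S" for \<delta>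
  proof -
    have "lookup F \<delta> \<in> graded_class \<nu> F \<delta>"
      using that by (auto simp: S_def gsupp_def graded_class_def mem_pcoset valuationD(4)[OF assms(1)])
    then have "rep \<delta> \<in> graded_class \<nu> F \<delta>" unfolding rep_def by (rule someI)
    then show ?thesis using that by (simp add: S_def gsupp_def graded_class_def mem_pcoset)
  qed
  have rep: "\<nu> (rep \<delta>) = Fin \<delta>" if "\<delta> \<in> S" for \<delta>
    using repd[OF that] that valuation_add_dominated[OF assms(1), of "lookup F \<delta>" "rep \<delta> - lookup F \<delta>"]
    by (simp add: S_def gsupp_graded_class[OF assms(1,4)])
  define H where "H \<delta> = Poly_Mapping.single \<delta> (rep \<delta>)" for \<delta>
  have H: "H \<delta> \<in> rees \<mu>" if "\<delta> \<in> S" for \<delta>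
    using rep[OF that] le[of "rep \<delta>"]
    by (auto simp: rees_def H_def lookup_single when_def valuationD(4)[OF assms(2)])
  have "graded_map \<nu> \<mu> (graded_class \<nu> F) = finsum (graded_ring \<mu>) (\<lambda>\<delta>. graded_class \<mu> (H \<delta>)) S"
    unfolding graded_map_def Let_def S_def[symmetric] rep_def[symmetric]
  proof -
    interpret cring "graded_ring \<mu>" by (rule presents_cring[OF P])
    show "finsum (graded_ring \<mu>) (\<lambda>\<delta>. if \<nu> (rep \<delta>) = \<mu> (rep \<delta>) then initial \<mu> (rep \<delta>) else \<zero>\<^bsub>graded_ring \<mu>\<^esub>) S =
      finsum (graded_ring \<mu>) (\<lambda>\<delta>. graded_class \<mu> (H \<delta>)) S"
    proof (rule finsum_cong')
      show "(\<lambda>\<delta>. graded_class \<mu> (H \<delta>)) \<in> S \<rightarrow> carrier (graded_ring \<mu>)"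
        using presentsD(2)[OF P] H by blast
      show "(if \<nu> (rep \<delta>) = \<mu> (rep \<delta>) then initial \<mu> (rep \<delta>) else \<zero>\<^bsub>graded_ring \<mu>\<^esub>) = graded_class \<mu> (H \<delta>)"
        if "\<delta> \<in> S" for \<delta>
        using graded_class_single[OF assms(2), of \<delta> "rep \<delta>"] rep[OF that] le[of "rep \<delta>"]
        by (auto simp: H_def graded_ring_def)
    qed simp
  qed
  also have "\<dots> = graded_class \<mu> (sum H S)"
    by (rule presents_finsum[OF P finS H])
  also have "\<dots> = graded_class \<mu> F"
  proof -
    have lookup_sum_H: "lookup (sum H S) \<delta> = (if \<delta> \<in> S then rep \<delta> else 0)" for \<delta>
      using finS by (simp add: lookup_sum H_def lookup_single when_def)
    have "Fin \<delta> < \<mu> (lookup (sum H S) \<delta> - lookup F \<delta>)" for \<delta>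
    proof (cases "\<delta> \<in> S")
      case True
      then show ?thesis using repd[OF True] le by (auto simp: lookup_sum_H intro: less_le_trans)
    next
      case False
      then have "Fin \<delta> < \<nu> (lookup F \<delta>)"
        using assms(4) by (auto simp: S_def gsupp_graded_class[OF assms(1,4)] rees_def order.not_eq_order_implies_strict)
      then show ?thesis
        using False le by (auto simp: lookup_sum_H valuation_uminus[OF assms(2)] intro: less_le_trans)
    qed
    moreover have "sum H S \<in> rees \<mu>" "F \<in> rees \<mu>"
      using subring_of_sum[OF presentsD(1)[OF P]] H rees_mono assms by blast+
    ultimately show ?thesis by (simp add: graded_class_eq_iff[OF assms(2)])
  qed
  finally show ?thesis .
qed

section \<open>Values of expansions\<close>

lemma nmul_simps [simp]: "nmul 0 x = 0" "nmul (Suc n) x = nmul n x + x"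
  by (simp_all add: nmul_def)

lemma nmul_Fin: "nmul n (Fin x) = Fin (nmul n x)"
  by (induction n) (simp_all add: zero_with_inf_def)

lemma nmul_Infty: "0 < n \<Longrightarrow> nmul n Infty = Infty"
  by (cases n) simp_all

lemma nmul_add: "nmul (m + n) x = nmul m x + nmul n x"
  by (induction n) (simp_all add: ac_simps)

lemma nmul_strict_mono:
  fixes x y :: "'g::linordered_ab_group_add"
  assumes "x < y" "0 < n"
  shows "nmul n x < nmul n y"
proof -
  have "nmul (Suc m) x < nmul (Suc m) y" for m
    using assms(1) by (induction m) (auto intro: add_strict_mono)
  then show ?thesis using assms(2) by (cases n) auto
qed

lemma nmul_with_inf_mono:
  fixes x y :: "'g::linordered_ab_group_add with_inf"
  shows "x \<le> y \<Longrightarrow> nmul n x \<le> nmul n y"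
  by (induction n) (simp_all add: with_inf_add_mono)

lemma value_line_strict_mono:
  fixes a x y :: "'g::linordered_ab_group_add with_inf"
  assumes "a \<noteq> Infty" "x < y" "0 < n"
  shows "a + nmul n x < a + nmul n y"
proof -
  obtain b z where "a = Fin b" "x = Fin z" using assms by (cases a; cases x) auto
  then show ?thesis
    using assms by (cases y) (auto simp: nmul_Fin nmul_Infty nmul_strict_mono)
qed

text \<open>The value \<open>a + j q\<close> of a term \<open>f Q\<^sup>j\<close> is, as a function of the value \<open>q\<close> of \<open>Q\<close>, a line of slope
  \<open>j\<close>; an ordered group has no torsion, so lines of different slopes meet at most once.\<close>

lemma value_lines_cross_once:
  fixes a b x y :: "'g::linordered_ab_group_add"
  assumes "j < l" "a + nmul j x = b + nmul l x" "a + nmul j y = b + nmul l y"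
  shows "x = y"
proof -
  obtain n where n: "l = j + n" "0 < n" using assms(1) less_imp_add_positive by blast
  have "b + nmul n x = b + nmul n y"
    using assms(2,3) by (simp add: n nmul_add algebra_simps)
  then show ?thesis
    using nmul_strict_mono[of x y n] nmul_strict_mono[of y x n] n(2) by (cases x y rule: linorder_cases) auto
qed

lemma valuation_power: "valuation \<nu> \<Longrightarrow> \<nu> (a ^ n) = nmul n (\<nu> a)"
  by (induction n) (simp_all add: valuationD zero_with_inf_def ac_simps)

text \<open>Two summands may share the value \<open>Infty\<close>, since adding an element of the support changes no value.\<close>

lemma valuation_sum_eq_Min:
  assumes "valuation \<nu>" "finite A" "A \<noteq> {}"
    and "\<And>i j. i \<in> A \<Longrightarrow> j \<in> A \<Longrightarrow> i \<noteq> j \<Longrightarrow> \<nu> (t i) \<noteq> \<nu> (t j) \<or> \<nu> (t i) = Infty"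
  shows "\<nu> (sum t A) = Min ((\<lambda>i. \<nu> (t i)) ` A)"
  using assms(2-)
proof (induction A rule: finite_ne_induct)
  case (insert a A)
  define S where "S = sum t A"
  have S: "\<nu> S = Min ((\<lambda>i. \<nu> (t i)) ` A)"
    unfolding S_def by (rule insert.IH) (use insert.prems in blast)
  have "\<nu> (t a + S) = min (\<nu> (t a)) (\<nu> S)"
  proof (cases "\<nu> (t a)" "\<nu> S" rule: linorder_cases)
    case less
    then show ?thesis using valuation_add_dominated[OF assms(1)] by simp
  next
    case greater
    then show ?thesis using valuation_add_dominated[OF assms(1), of S "t a"] by (simp add: add.commute)
  next
    case equal
    have "\<nu> S \<in> (\<lambda>i. \<nu> (t i)) ` A"
      unfolding S using insert.hyps by (intro Min_in) auto
    then obtain i where "i \<in> A" "\<nu> S = \<nu> (t i)" by blast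
    with equal insert.prems[of a i] insert.hyps have "\<nu> (t a) = Infty" by auto
    with equal show ?thesis using valuation_add_ge[OF assms(1), of Infty "t a" S] by simp
  qed
  then show ?case using insert.hyps S by (simp add: S_def)
qed simp

lemma expansion_exists:
  fixes p Q :: "'k::field poly"
  assumes "0 < degree Q"
  shows "\<exists>f r. (\<forall>j. degree (f j) < degree Q) \<and> p = (\<Sum>j\<le>(r::nat). f j * Q ^ j)"
proof (induction "degree p" arbitrary: p rule: less_induct)
  case less
  show ?case
  proof (cases "degree p < degree Q")
    case True
    then show ?thesis
      using assms by (intro exI[of _ "\<lambda>j. if j = 0 then p else 0"] exI[of _ 0]) auto
  next
    case False
    then have "degree (p div Q) < degree p"
      using assms by (intro degree_div_less) auto
    with less obtain g r where g: "\<forall>j. degree (g j) < degree Q" "p div Q = (\<Sum>j\<le>(r::nat). g j * Q ^ j)"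
      by blast
    have "degree (p mod Q) < degree Q"
      using assms degree_mod_less[of Q p] by force
    moreover have "p = (\<Sum>j\<le>Suc r. (case j of 0 \<Rightarrow> p mod Q | Suc i \<Rightarrow> g i) * Q ^ j)"
    proof -
      have "p = p mod Q + (p div Q) * Q" by simp
      also have "(p div Q) * Q = (\<Sum>j\<le>r. g j * Q ^ Suc j)"
        unfolding g(2) by (simp add: sum_distrib_left ac_simps)
      finally show ?thesis by (simp only: sum.atMost_Suc_shift) simp
    qed
    ultimately show ?thesis
      using g(1) by (intro exI[of _ "\<lambda>j. case j of 0 \<Rightarrow> p mod Q | Suc i \<Rightarrow> g i"] exI[of _ "Suc r"])
        (auto split: nat.split)
  qed
qed

section \<open>Chains of valuations and eventual values\<close>

locale valuation_chain =
  fixes I :: "'i set" and \<nu> :: "'i \<Rightarrow> 'k::field poly \<Rightarrow> 'g::linordered_ab_group_add with_inf"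
  assumes nonempty: "I \<noteq> {}"
    and valuation: "i \<in> I \<Longrightarrow> valuation (\<nu> i)"
    and total: "i \<in> I \<Longrightarrow> j \<in> I \<Longrightarrow> \<nu> i \<le> \<nu> j \<or> \<nu> j \<le> \<nu> i"
begin

text \<open>The filter of the properties that hold for all late members of the chain. A polynomial is stable
  when its value is eventually constant along it.\<close>

definition tails :: "'i filter" where
  "tails = (INF i\<in>I. principal {j \<in> I. \<nu> i \<le> \<nu> j})"

lemma eventually_tails:
  "eventually P tails \<longleftrightarrow> (\<exists>i\<in>I. \<forall>j\<in>I. \<nu> i \<le> \<nu> j \<longrightarrow> P j)"
proof -
  have "eventually P tails \<longleftrightarrow> (\<exists>i\<in>I. eventually P (principal {j \<in> I. \<nu> i \<le> \<nu> j}))"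
    unfolding tails_def
  proof (rule eventually_INF_base[OF nonempty])
    fix i j assume ij: "i \<in> I" "j \<in> I"
    then have "\<exists>x\<in>I. \<nu> i \<le> \<nu> x \<and> \<nu> j \<le> \<nu> x" using total by blast
    then show "\<exists>x\<in>I. principal {k \<in> I. \<nu> x \<le> \<nu> k}
        \<le> inf (principal {k \<in> I. \<nu> i \<le> \<nu> k}) (principal {k \<in> I. \<nu> j \<le> \<nu> k})"
      by (auto intro: order_trans)
  qed
  then show ?thesis by (auto simp: eventually_principal)
qed

lemma eventually_above: "i \<in> I \<Longrightarrow> eventually (\<lambda>k. k \<in> I \<and> \<nu> i \<le> \<nu> k) tails"
  unfolding eventually_tails by blast

lemma eventually_tails_ex: "eventually P tails \<Longrightarrow> \<exists>k\<in>I. P k"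
  unfolding eventually_tails by blast

lemma eventually_mem: "eventually (\<lambda>k. k \<in> I) tails"
  using nonempty unfolding eventually_tails by blast

lemma v_stable_iff: "v_stable I \<nu> f \<longleftrightarrow> (\<exists>c. eventually (\<lambda>k. \<nu> k f = c) tails)"
proof
  assume "v_stable I \<nu> f"
  then show "\<exists>c. eventually (\<lambda>k. \<nu> k f = c) tails"
    unfolding v_stable_def eventually_tails by blast
next
  assume "\<exists>c. eventually (\<lambda>k. \<nu> k f = c) tails"
  then obtain c i where "i \<in> I" "\<forall>j\<in>I. \<nu> i \<le> \<nu> j \<longrightarrow> \<nu> j f = c"
    unfolding eventually_tails by blast
  then show "v_stable I \<nu> f"
    unfolding v_stable_def by (intro bexI[of _ i]) auto
qed

lemma stable_value_eqI:
  assumes "eventually (\<lambda>k. \<nu> k f = c) tails"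
  shows "stable_value I \<nu> f = c"
  unfolding stable_value_def
proof (rule the_equality)
  obtain i where "i \<in> I" "\<forall>j\<in>I. \<nu> i \<le> \<nu> j \<longrightarrow> \<nu> j f = c"
    using assms unfolding eventually_tails by blast
  then show "\<exists>i\<in>I. (\<forall>j\<in>I. \<nu> i \<le> \<nu> j \<longrightarrow> \<nu> j f = \<nu> i f) \<and> c = \<nu> i f"
    by (intro bexI[of _ i]) auto
next
  fix c' assume "\<exists>i\<in>I. (\<forall>j\<in>I. \<nu> i \<le> \<nu> j \<longrightarrow> \<nu> j f = \<nu> i f) \<and> c' = \<nu> i f"
  then have "eventually (\<lambda>k. \<nu> k f = c') tails" unfolding eventually_tails by blast
  with assms have "eventually (\<lambda>k. c' = c) tails" by eventually_elim auto
  then show "c' = c" using eventually_tails_ex by blast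
qed

lemma eventually_stable_value:
  "v_stable I \<nu> f \<Longrightarrow> eventually (\<lambda>k. \<nu> k f = stable_value I \<nu> f) tails"
  using stable_value_eqI v_stable_iff by metis

lemma eventually_zero: "eventually (\<lambda>k. \<nu> k 0 = Infty) tails"
  using eventually_mem by eventually_elim (simp add: valuationD(4)[OF valuation])

end

section \<open>The extension of a chain by an unstable polynomial\<close>

locale limit_extension = valuation_chain I \<nu>
  for I :: "'i set" and \<nu> :: "'i \<Rightarrow> 'k::field poly \<Rightarrow> 'g::linordered_ab_group_add with_inf" +
  fixes Q :: "'k poly" and \<gamma> :: "'g with_inf"
    and \<mu> :: "'k poly \<Rightarrow> 'g with_inf"
  assumes degree_Q: "0 < degree Q"
    and Q_not_stable: "\<not> v_stable I \<nu> Q"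
    and small_stable: "degree f < degree Q \<Longrightarrow> v_stable I \<nu> f"
    and below_\<gamma>: "i \<in> I \<Longrightarrow> \<nu> i Q < \<gamma>"
    and valuation_\<mu>: "valuation \<mu>"
    and \<mu>_expansion: "(\<And>j. j \<le> r \<Longrightarrow> degree (h j) < degree Q) \<Longrightarrow>
       \<mu> (\<Sum>j\<le>(r::nat). h j * Q ^ j) = Min ((\<lambda>j. stable_value I \<nu> (h j) + nmul j \<gamma>) ` {..r})"
begin

text \<open>The value that the term \<open>f Q\<^sup>j\<close> has when \<open>f\<close> has its stable value and \<open>Q\<close> has value \<open>q\<close>. By
  hypothesis \<open>\<mu>\<close> takes the minimum of these lines at \<open>q = \<gamma>\<close>.\<close>

abbreviation line :: "'k poly \<Rightarrow> nat \<Rightarrow> 'g with_inf \<Rightarrow> 'g with_inf" where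
  "line f j q \<equiv> stable_value I \<nu> f + nmul j q"

lemma eventually_Q_greater:
  assumes "k \<in> I"
  shows "eventually (\<lambda>l. \<nu> k Q < \<nu> l Q) tails"
proof -
  obtain l where l: "l \<in> I" "\<nu> k \<le> \<nu> l" "\<nu> l Q \<noteq> \<nu> k Q"
    using Q_not_stable assms unfolding v_stable_def by blast
  then have "\<nu> k Q < \<nu> l Q" by (metis le_funD order.not_eq_order_implies_strict)
  moreover have "\<nu> l Q \<le> \<nu> m Q" if "\<nu> l \<le> \<nu> m" for m using that by (rule le_funD)
  ultimately show ?thesis unfolding eventually_tails using l(1) less_le_trans by blast
qed

text \<open>The values of \<open>Q\<close> never decrease along the chain and are never the largest ones, so each
  element is passed for good.\<close>

lemma eventually_Q_neq: "eventually (\<lambda>k. \<nu> k Q \<noteq> c) tails"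
proof (cases "\<exists>k\<in>I. \<nu> k Q = c")
  case True
  then obtain k where "k \<in> I" "\<nu> k Q = c" by blast
  then show ?thesis using eventually_Q_greater[of k] by (auto elim: eventually_mono)
next
  case False
  show ?thesis using eventually_mem by eventually_elim (use False in blast)
qed

lemma Q_finite: "k \<in> I \<Longrightarrow> \<nu> k Q \<noteq> Infty"
  using below_\<gamma>[of k] by auto

text \<open>Two lines with finite values cross at one value of \<open>Q\<close> at most, and that value is eventually left behind.\<close>

lemma eventually_lines_distinct:
  assumes "j < l"
  shows "eventually (\<lambda>k. line f j (\<nu> k Q) = line g l (\<nu> k Q) \<longrightarrow> line f j (\<nu> k Q) = Infty) tails"
proof (cases "\<exists>a b x. stable_value I \<nu> f = Fin a \<and> stable_value I \<nu> g = Fin b \<and> a + nmul j x = b + nmul l x")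
  case True
  then obtain a b x where ab: "stable_value I \<nu> f = Fin a" "stable_value I \<nu> g = Fin b"
    and x: "a + nmul j x = b + nmul l x" by blast
  have "eventually (\<lambda>k. \<nu> k Q \<noteq> Fin x) tails" by (rule eventually_Q_neq)
  with eventually_mem show ?thesis
  proof eventually_elim
    case (elim k)
    then obtain y where "\<nu> k Q = Fin y" "y \<noteq> x" using Q_finite by (cases "\<nu> k Q") auto
    then show ?case using value_lines_cross_once[OF assms x, of y] by (auto simp: ab nmul_Fin)
  qed
next
  case False
  show ?thesis
    using eventually_mem
  proof eventually_elim
    case (elim k)
    then obtain y where "\<nu> k Q = Fin y" using Q_finite by (cases "\<nu> k Q") auto
    then show ?case
      using False by (cases "stable_value I \<nu> f"; cases "stable_value I \<nu> g") (auto simp: nmul_Fin)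
  qed
qed

text \<open>The terms of a \<open>Q\<close>-expansion eventually have pairwise distinct values, infinite ones apart, so
  no cancellation can raise the value of the sum. Late members of the chain thus satisfy the same
  formula as \<open>\<mu>\<close>, with the value of \<open>Q\<close> in place of \<open>\<gamma>\<close>; every comparison of the chain with \<open>\<mu>\<close> below
  rests on this.\<close>

lemma eventually_value_expansion:
  assumes f: "\<And>j. degree (f j) < degree Q"
  shows "eventually (\<lambda>k. \<nu> k (\<Sum>j\<le>(r::nat). f j * Q ^ j) = Min ((\<lambda>j. line (f j) j (\<nu> k Q)) ` {..r})) tails"
proof -
  have "eventually (\<lambda>k. \<forall>j\<in>{..r}. \<nu> k (f j) = stable_value I \<nu> (f j)) tails"
    using eventually_stable_value[OF small_stable[OF f]] by (simp add: eventually_ball_finite_distrib)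
  moreover have "eventually (\<lambda>k. \<forall>j\<in>{..r}. \<forall>l\<in>{..r}. j < l \<longrightarrow>
      (line (f j) j (\<nu> k Q) = line (f l) l (\<nu> k Q) \<longrightarrow> line (f j) j (\<nu> k Q) = Infty)) tails"
    using eventually_lines_distinct by (simp add: eventually_ball_finite_distrib)
  ultimately show ?thesis
    using eventually_mem
  proof eventually_elim
    case (elim k)
    have eq: "\<nu> k (f j * Q ^ j) = line (f j) j (\<nu> k Q)" if "j \<le> r" for j
      using elim that by (simp add: valuationD(1)[OF valuation] valuation_power[OF valuation])
    have "\<nu> k (\<Sum>j\<le>r. f j * Q ^ j) = Min ((\<lambda>j. \<nu> k (f j * Q ^ j)) ` {..r})"
    proof (rule valuation_sum_eq_Min)
      fix j l assume jl: "j \<in> {..r}" "l \<in> {..r}" "j \<noteq> l"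
      then consider "j < l" | "l < j" by linarith
      then show "\<nu> k (f j * Q ^ j) \<noteq> \<nu> k (f l * Q ^ l) \<or> \<nu> k (f j * Q ^ j) = Infty"
        using elim(2) jl(1,2) by cases (metis eq atMost_iff)+
    qed (use elim valuation in auto)
    also have "\<dots> = Min ((\<lambda>j. line (f j) j (\<nu> k Q)) ` {..r})"
      by (simp add: eq cong: image_cong_simp)
    finally show ?case .
  qed
qed

lemma chain_le_\<mu>:
  assumes "i \<in> I"
  shows "\<nu> i \<le> \<mu>"
proof (rule le_funI)
  fix p
  obtain f r where f: "\<And>j. degree (f j) < degree Q" and p: "p = (\<Sum>j\<le>(r::nat). f j * Q ^ j)"
    using expansion_exists[OF degree_Q, of p] by blast
  have "eventually (\<lambda>k. (k \<in> I \<and> \<nu> i \<le> \<nu> k) \<and> \<nu> k p = Min ((\<lambda>j. line (f j) j (\<nu> k Q)) ` {..r})) tails"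
    unfolding p using eventually_above[OF assms] eventually_value_expansion[OF f] by (rule eventually_conj)
  then obtain k where k: "k \<in> I" "\<nu> i \<le> \<nu> k" "\<nu> k p = Min ((\<lambda>j. line (f j) j (\<nu> k Q)) ` {..r})"
    using eventually_tails_ex by blast
  have "\<nu> i p \<le> \<nu> k p" using k(2) by (rule le_funD)
  also have "\<dots> \<le> Min ((\<lambda>j. line (f j) j \<gamma>) ` {..r})"
  proof (rule Min.boundedI)
    fix a assume "a \<in> (\<lambda>j. line (f j) j \<gamma>) ` {..r}"
    then obtain j where j: "j \<le> r" "a = line (f j) j \<gamma>" by auto
    have "\<nu> k p \<le> line (f j) j (\<nu> k Q)" unfolding k(3) using j by (intro Min_le) auto
    also have "\<dots> \<le> a"
      unfolding j(2) using below_\<gamma>[OF k(1)] by (intro with_inf_add_mono nmul_with_inf_mono) auto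
    finally show "\<nu> k p \<le> a" .
  qed auto
  also have "\<dots> = \<mu> p" unfolding p using f by (simp add: \<mu>_expansion)
  finally show "\<nu> i p \<le> \<mu> p" .
qed

lemma eventually_value_eq_\<mu>:
  assumes "degree f < degree Q"
  shows "eventually (\<lambda>k. \<nu> k f = \<mu> f) tails"
proof -
  have "\<mu> f = stable_value I \<nu> f" using \<mu>_expansion[where r = 0 and h = "\<lambda>_. f"] assms by simp
  then show ?thesis using eventually_stable_value[OF small_stable[OF assms]] by simp
qed

text \<open>A stable polynomial has the value that \<open>\<mu>\<close> gives it. For if the minimum of the lines stays at a
  constant finite value while the value of \<open>Q\<close> grows, then it is reached by the line of slope \<open>0\<close>,
  whose value does not change on passing to \<open>\<gamma>\<close>. This makes the limit of the graded rings embed into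
  the graded ring of \<open>\<mu>\<close>.\<close>

lemma value_grows_below_\<mu>:
  assumes "i \<in> I" "\<nu> i p < \<mu> p"
  shows "eventually (\<lambda>k. \<nu> i p < \<nu> k p) tails"
proof -
  obtain f r where f: "\<And>j. degree (f j) < degree Q" and p: "p = (\<Sum>j\<le>(r::nat). f j * Q ^ j)"
    using expansion_exists[OF degree_Q, of p] by blast
  have ev: "eventually (\<lambda>k. \<nu> k p = Min ((\<lambda>j. line (f j) j (\<nu> k Q)) ` {..r})) tails"
    unfolding p by (rule eventually_value_expansion[OF f])
  have "\<exists>k\<in>I. \<nu> i \<le> \<nu> k \<and> \<nu> k p \<noteq> \<nu> i p"
  proof (rule ccontr)
    assume "\<not> (\<exists>k\<in>I. \<nu> i \<le> \<nu> k \<and> \<nu> k p \<noteq> \<nu> i p)"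
    then have const: "eventually (\<lambda>k. \<nu> k p = \<nu> i p) tails"
      using assms(1) unfolding eventually_tails by blast
    have ev': "eventually (\<lambda>k. \<nu> i p = Min ((\<lambda>j. line (f j) j (\<nu> k Q)) ` {..r})) tails"
      using ev const by eventually_elim simp
    then obtain k where k: "k \<in> I" "\<nu> i p = Min ((\<lambda>j. line (f j) j (\<nu> k Q)) ` {..r})"
      using eventually_tails_ex by blast
    have "eventually (\<lambda>l. \<nu> k Q < \<nu> l Q \<and> \<nu> i p = Min ((\<lambda>j. line (f j) j (\<nu> l Q)) ` {..r})) tails"
      using eventually_Q_greater[OF k(1)] ev' by (rule eventually_conj)
    then obtain l where l: "l \<in> I" "\<nu> k Q < \<nu> l Q" "\<nu> i p = Min ((\<lambda>j. line (f j) j (\<nu> l Q)) ` {..r})"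
      using eventually_tails_ex by blast
    \<comment> \<open>Now \<open>k\<close> and the later \<open>l\<close> have the same minimum although \<open>Q\<close> has a larger value at \<open>l\<close>. A line of
      positive slope through the minimum at \<open>l\<close> would lie below it at \<open>k\<close>.\<close>
    have "\<nu> i p \<in> (\<lambda>j. line (f j) j (\<nu> l Q)) ` {..r}"
      unfolding l(3) by (rule Min_in) auto
    then obtain j where j: "j \<le> r" "\<nu> i p = line (f j) j (\<nu> l Q)" by auto
    show False
    proof (cases "j = 0")
      case True
      have "\<mu> p \<le> line (f 0) 0 \<gamma>"
        unfolding p \<mu>_expansion[OF f] by (rule Min_le) (auto simp del: nmul_simps)
      also have "\<dots> = \<nu> i p" using j True by simp
      finally show False using assms(2) by simp
    next
      case False
      have "stable_value I \<nu> (f j) \<noteq> Infty" using assms(2) j(2) by auto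
      then have "line (f j) j (\<nu> k Q) < \<nu> i p"
        unfolding j(2) using l(2) False by (intro value_line_strict_mono) auto
      moreover have "\<nu> i p \<le> line (f j) j (\<nu> k Q)"
        unfolding k(2) using j(1) by (intro Min_le) auto
      ultimately show False by simp
    qed
  qed
  then obtain k where k: "k \<in> I" "\<nu> i \<le> \<nu> k" "\<nu> k p \<noteq> \<nu> i p" by blast
  then have "\<nu> i p < \<nu> k p" by (metis le_funD order.not_eq_order_implies_strict)
  then show ?thesis
    using k(1) unfolding eventually_tails by (blast intro: less_le_trans le_funD)
qed

text \<open>If \<open>\<nu> i p = \<mu> p\<close>, the minimum of the lines does not grow between the value of \<open>Q\<close> at a late stage
  and \<open>\<gamma>\<close>. The lines of positive slope do grow, so at \<open>\<gamma>\<close> they exceed the minimum, and the constant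
  term \<open>g\<close> of the expansion alone has the initial form of \<open>p\<close>.\<close>

lemma initial_form_of_small_degree:
  assumes "i \<in> I" "\<nu> i p = \<mu> p" "\<mu> p = Fin \<delta>"
  obtains g where "degree g < degree Q" "Fin \<delta> < \<mu> (p - g)"
proof -
  obtain f r where f: "\<And>j. degree (f j) < degree Q" and p: "p = (\<Sum>j\<le>(r::nat). f j * Q ^ j)"
    using expansion_exists[OF degree_Q, of p] by blast
  have "eventually (\<lambda>k. (k \<in> I \<and> \<nu> i \<le> \<nu> k) \<and> \<nu> k p = Min ((\<lambda>j. line (f j) j (\<nu> k Q)) ` {..r})) tails"
    unfolding p using eventually_above[OF assms(1)] eventually_value_expansion[OF f] by (rule eventually_conj)
  then obtain k where k: "k \<in> I" "\<nu> i \<le> \<nu> k" "\<nu> k p = Min ((\<lambda>j. line (f j) j (\<nu> k Q)) ` {..r})"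
    using eventually_tails_ex by blast
  have kp: "Fin \<delta> \<le> \<nu> k p"
    using le_funD[OF k(2), of p] assms by simp
  \<comment> \<open>\<open>p - f 0\<close> is kept as an expansion of the same length, whose constant term has value \<open>Infty\<close>.\<close>
  define h where "h = f(0 := 0)"
  have h: "degree (h j) < degree Q" for j using f degree_Q by (simp add: h_def)
  have "p - f 0 = (\<Sum>j\<le>r. h j * Q ^ j)"
  proof -
    have "(\<Sum>j\<le>r. h j * Q ^ j) = (\<Sum>j\<le>r. f j * Q ^ j - (if j = 0 then f 0 else 0))"
      by (rule sum.cong) (auto simp: h_def)
    then show ?thesis by (simp add: sum_subtractf p)
  qed
  then have "\<mu> (p - f 0) = Min ((\<lambda>j. line (h j) j \<gamma>) ` {..r})"
    using \<mu>_expansion h by simp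
  moreover have "Fin \<delta> < line (h j) j \<gamma>" if "j \<le> r" for j
  proof (cases "j = 0 \<or> stable_value I \<nu> (h j) = Infty")
    case True
    then have "stable_value I \<nu> (h j) = Infty"
      using stable_value_eqI[OF eventually_zero] by (auto simp: h_def)
    then show ?thesis by simp
  next
    case False
    have "Fin \<delta> \<le> line (f j) j (\<nu> k Q)"
      using kp unfolding k(3) by (rule order_trans) (use that in \<open>auto intro: Min_le\<close>)
    also have "\<dots> < line (f j) j \<gamma>"
      using False below_\<gamma>[OF k(1)] by (intro value_line_strict_mono) (auto simp: h_def)
    finally show ?thesis using False by (simp add: h_def)
  qed
  ultimately have "Fin \<delta> < \<mu> (p - f 0)" by simp
  with f that show thesis by blast
qed

subsection \<open>The subring generated by small degrees is the direct limit\<close>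

definition chain_rees :: "('g \<Rightarrow>\<^sub>0 'k poly) set" where
  "chain_rees = (\<Union>i\<in>I. rees (\<nu> i))"

lemma chain_rees_subset: "chain_rees \<subseteq> rees \<mu>"
  unfolding chain_rees_def using rees_mono chain_le_\<mu> by blast

text \<open>The elements of the union of the Rees algebras identified in the graded ring of \<open>\<mu>\<close> are those
  identified at some stage of the chain. Only finitely many degrees matter, so a stage late enough for
  each of them serves for all.\<close>

lemma graded_class_\<mu>_eq_iff:
  assumes F: "F \<in> chain_rees" and G: "G \<in> chain_rees"
  shows "graded_class \<mu> F = graded_class \<mu> G \<longleftrightarrow>
    (\<exists>k\<in>I. F \<in> rees (\<nu> k) \<and> G \<in> rees (\<nu> k) \<and> graded_class (\<nu> k) F = graded_class (\<nu> k) G)"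
proof
  assume "\<exists>k\<in>I. F \<in> rees (\<nu> k) \<and> G \<in> rees (\<nu> k) \<and> graded_class (\<nu> k) F = graded_class (\<nu> k) G"
  then obtain k where k: "k \<in> I" "F \<in> rees (\<nu> k)" "G \<in> rees (\<nu> k)"
    "graded_class (\<nu> k) F = graded_class (\<nu> k) G" by blast
  then have "Fin \<delta> < \<mu> (lookup F \<delta> - lookup G \<delta>)" for \<delta>
    using graded_class_eq_iff[OF valuation] le_funD[OF chain_le_\<mu>] less_le_trans by metis
  then show "graded_class \<mu> F = graded_class \<mu> G"
    using graded_class_eq_iff[OF valuation_\<mu>] F G chain_rees_subset by blast
next
  assume eq: "graded_class \<mu> F = graded_class \<mu> G"
  have gt: "Fin \<delta> < \<mu> (lookup F \<delta> - lookup G \<delta>)" for \<delta>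
    using eq graded_class_eq_iff[OF valuation_\<mu>] F G chain_rees_subset by blast
  obtain i j where "i \<in> I" "F \<in> rees (\<nu> i)" "j \<in> I" "G \<in> rees (\<nu> j)"
    using F G unfolding chain_rees_def by blast
  then obtain m where m: "m \<in> I" "F \<in> rees (\<nu> m)" "G \<in> rees (\<nu> m)"
    using total rees_mono by blast
  define S where "S = keys F \<union> keys G"
  have "eventually (\<lambda>k. Fin \<delta> < \<nu> k (lookup F \<delta> - lookup G \<delta>)) tails" for \<delta>
  proof -
    have ge: "Fin \<delta> \<le> \<nu> m (lookup F \<delta> - lookup G \<delta>)"
      using m by (intro valuation_diff_ge[OF valuation]) (auto simp: rees_def)
    show ?thesis
    proof (cases "Fin \<delta> < \<nu> m (lookup F \<delta> - lookup G \<delta>)")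
      case True
      then show ?thesis
        using eventually_above[OF m(1)] by (auto elim!: eventually_mono dest: le_funD intro: less_le_trans)
    next
      case False
      with ge have "\<nu> m (lookup F \<delta> - lookup G \<delta>) = Fin \<delta>" by auto
      then show ?thesis using value_grows_below_\<mu>[OF m(1)] gt by metis
    qed
  qed
  then have "eventually (\<lambda>k. \<forall>\<delta>\<in>S. Fin \<delta> < \<nu> k (lookup F \<delta> - lookup G \<delta>)) tails"
    by (simp add: eventually_ball_finite_distrib S_def)
  then have "eventually (\<lambda>k. (k \<in> I \<and> \<nu> m \<le> \<nu> k) \<and> (\<forall>\<delta>\<in>S. Fin \<delta> < \<nu> k (lookup F \<delta> - lookup G \<delta>))) tails"
    using eventually_above[OF m(1)] by (rule eventually_conj[rotated])
  then obtain k where k: "k \<in> I" "\<nu> m \<le> \<nu> k" "\<forall>\<delta>\<in>S. Fin \<delta> < \<nu> k (lookup F \<delta> - lookup G \<delta>)"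
    using eventually_tails_ex by blast
  have "Fin \<delta> < \<nu> k (lookup F \<delta> - lookup G \<delta>)" for \<delta>
  proof (cases "\<delta> \<in> S")
    case False
    then have "lookup F \<delta> = 0" "lookup G \<delta> = 0" by (auto simp: S_def in_keys_iff)
    then show ?thesis using valuationD(4)[OF valuation[OF k(1)]] by simp
  qed (use k in blast)
  moreover have "F \<in> rees (\<nu> k)" "G \<in> rees (\<nu> k)" using m k rees_mono by blast+
  ultimately show "\<exists>k\<in>I. F \<in> rees (\<nu> k) \<and> G \<in> rees (\<nu> k) \<and> graded_class (\<nu> k) F = graded_class (\<nu> k) G"
    using graded_class_eq_iff[OF valuation[OF k(1)]] k(1) by blast
qed

lemma subring_of_chain_rees: "subring_of chain_rees"
proof -
  have closed: "subring_of (rees (\<nu> i))" if "i \<in> I" for i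
    by (rule subring_of_rees[OF valuation[OF that]])
  have "F + G \<in> chain_rees \<and> F * G \<in> chain_rees" if FG: "F \<in> chain_rees" "G \<in> chain_rees" for F G
  proof -
    obtain i j where "i \<in> I" "F \<in> rees (\<nu> i)" "j \<in> I" "G \<in> rees (\<nu> j)"
      using FG unfolding chain_rees_def by blast
    then obtain m where "m \<in> I" "F \<in> rees (\<nu> m)" "G \<in> rees (\<nu> m)"
      using total rees_mono by blast
    then show ?thesis
      using subring_of_closed(3,4)[OF closed[OF \<open>m \<in> I\<close>], of F G] unfolding chain_rees_def by blast
  qed
  moreover have "- F \<in> chain_rees" if "F \<in> chain_rees" for F
    using that subring_of_closed(5)[OF closed] by (auto simp: chain_rees_def)
  moreover obtain i where "i \<in> I" using nonempty by blast
  then have "0 \<in> chain_rees" "1 \<in> chain_rees"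
    using subring_of_closed(1,2)[OF closed[OF \<open>i \<in> I\<close>]] unfolding chain_rees_def by blast+
  ultimately show ?thesis unfolding subring_of_def by blast
qed

text \<open>A family is the sum of its homogeneous parts. A part \<open>p\<close> of degree \<open>\<delta>\<close> with non-zero class satisfies
  \<open>\<delta> \<le> \<nu> i p \<le> \<mu> p = \<delta>\<close>, hence its class is the initial form of a polynomial of small degree.\<close>

lemma graded_class_in_generate:
  assumes "F \<in> chain_rees"
  shows "graded_class \<mu> F \<in> generate (add_monoid (graded_ring \<mu>)) {initial \<mu> f | f. degree f < degree Q}"
    (is "_ \<in> ?R")
proof -
  note P = presentsD[OF presents_graded_ring[OF valuation_\<mu>]]
  obtain i where i: "i \<in> I" "F \<in> rees (\<nu> i)" using assms unfolding chain_rees_def by blast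
  define H where "H \<delta> = Poly_Mapping.single \<delta> (lookup F \<delta>)" for \<delta>
  have \<nu>_ge: "Fin \<delta> \<le> \<nu> i (lookup F \<delta>)" for \<delta> using i(2) by (simp add: rees_def)
  have le: "\<nu> i p \<le> \<mu> p" for p using chain_le_\<mu>[OF i(1)] by (rule le_funD)
  have \<mu>_ge: "Fin \<delta> \<le> \<mu> (lookup F \<delta>)" for \<delta> using \<nu>_ge le order_trans by blast
  have H: "H \<delta> \<in> rees \<mu>" for \<delta>
    using \<mu>_ge by (auto simp: rees_def H_def lookup_single when_def valuationD(4)[OF valuation_\<mu>])
  have zero: "\<one>\<^bsub>graded_group \<mu>\<^esub> \<in> ?R"
    using generate.one[of "add_monoid (graded_ring \<mu>)"] by (simp add: graded_ring_def)
  have H_in: "graded_class \<mu> (H \<delta>) \<in> ?R" for \<delta>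
  proof (cases "\<mu> (lookup F \<delta>) = Fin \<delta>")
    case True
    then have "\<nu> i (lookup F \<delta>) = \<mu> (lookup F \<delta>)" using \<nu>_ge[of \<delta>] le[of "lookup F \<delta>"] by auto
    then obtain g where g: "degree g < degree Q" "Fin \<delta> < \<mu> (lookup F \<delta> - g)"
      using initial_form_of_small_degree[OF i(1)] True by metis
    have "\<mu> g = Fin \<delta>"
      using valuation_add_dominated[OF valuation_\<mu>, of "lookup F \<delta>" "g - lookup F \<delta>"] g(2) True
        valuation_uminus[OF valuation_\<mu>, of "lookup F \<delta> - g"] by simp
    have "graded_class \<mu> (H \<delta>) = graded_class \<mu> (Poly_Mapping.single \<delta> g)"
    proof (subst graded_class_eq_iff[OF valuation_\<mu> H])
      show "Poly_Mapping.single \<delta> g \<in> rees \<mu>"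
        using \<open>\<mu> g = Fin \<delta>\<close> by (auto simp: rees_def lookup_single when_def valuationD(4)[OF valuation_\<mu>])
      show "\<forall>\<epsilon>. Fin \<epsilon> < \<mu> (lookup (H \<delta>) \<epsilon> - lookup (Poly_Mapping.single \<delta> g) \<epsilon>)"
        using g(2) by (auto simp: H_def lookup_single when_def valuationD(4)[OF valuation_\<mu>])
    qed
    also have "\<dots> = initial \<mu> g"
      using graded_class_single[OF valuation_\<mu>, of \<delta> g] \<open>\<mu> g = Fin \<delta>\<close> by simp
    also have "\<dots> \<in> ?R" using g(1) by (intro generate.incl) blast
    finally show ?thesis .
  next
    case False
    then show ?thesis
      using graded_class_single[OF valuation_\<mu> \<mu>_ge[of \<delta>]] zero by (simp add: H_def)
  qed
  have sum_in: "graded_class \<mu> (sum H A) \<in> ?R" if "finite A" for A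
    using that
  proof (induction A rule: finite_induct)
    case empty
    then show ?case using zero P(3) by (simp add: graded_ring_def)
  next
    case (insert a A)
    have "graded_class \<mu> (sum H (insert a A)) = graded_class \<mu> (H a) \<oplus>\<^bsub>graded_ring \<mu>\<^esub> graded_class \<mu> (sum H A)"
      using insert.hyps P(5)[OF H subring_of_sum[OF P(1) H]] by simp
    then show ?case using generate.eng[OF H_in insert.IH] by simp
  qed
  have "F = sum H (keys F)"
    by (rule poly_mapping_eqI) (simp add: lookup_sum H_def lookup_single when_def in_keys_iff)
  then show ?thesis using sum_in[of "keys F"] by simp
qed

text \<open>A polynomial \<open>f\<close> of small degree is stable with value \<open>\<mu> f\<close>. If this is finite, \<open>f\<close> is at some stage
  a homogeneous element of degree \<open>\<mu> f\<close>; otherwise its initial form is \<open>0\<close>. So every generator is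
  reached.\<close>

lemma presents_R_sub: "presents chain_rees (graded_class \<mu>) (R_sub \<mu> (degree Q))"
proof -
  note pres = presents_graded_ring[OF valuation_\<mu>]
  note P = presentsD[OF pres]
  note C = subring_of_closed[OF subring_of_chain_rees]
  interpret cring "graded_ring \<mu>" by (rule presents_cring[OF pres])
  have "generate (add_monoid (graded_ring \<mu>)) {initial \<mu> f | f. degree f < degree Q} = graded_class \<mu> ` chain_rees"
  proof (intro equalityI subsetI)
    have init: "initial \<mu> f \<in> graded_class \<mu> ` chain_rees" if f: "degree f < degree Q" for f
    proof (cases "\<mu> f")
      case (Fin \<delta>)
      have "eventually (\<lambda>k. k \<in> I \<and> \<nu> k f = \<mu> f) tails"
        using eventually_mem eventually_value_eq_\<mu>[OF f] by (rule eventually_conj)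
      from eventually_tails_ex[OF this] Fin obtain k where "k \<in> I" "\<nu> k f = Fin \<delta>" by auto
      then have "Poly_Mapping.single \<delta> f \<in> chain_rees"
        unfolding chain_rees_def
        by (auto simp: rees_def lookup_single when_def valuationD(4)[OF valuation] intro!: bexI[of _ k])
      moreover have "initial \<mu> f = graded_class \<mu> (Poly_Mapping.single \<delta> f)"
        using graded_class_single[OF valuation_\<mu>, of \<delta> f] Fin by simp
      ultimately show ?thesis by blast
    next
      case Infty
      then have "initial \<mu> f = graded_class \<mu> 0"
        by (simp add: P(3)) (simp add: initial_def graded_ring_def)
      then show ?thesis using C(1) by blast
    qed
    fix s assume "s \<in> generate (add_monoid (graded_ring \<mu>)) {initial \<mu> f | f. degree f < degree Q}"
    then show "s \<in> graded_class \<mu> ` chain_rees"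
    proof induction
      case one
      then show ?case using P(3) C(1) by (metis imageI monoid.select_convs(2))
    next
      case (incl s)
      then show ?case using init by blast
    next
      case (inv s)
      then obtain F where F: "F \<in> chain_rees" "s = graded_class \<mu> F" using init by blast
      then have R: "F \<in> rees \<mu>" "- F \<in> rees \<mu>" using C(5) chain_rees_subset by blast+
      then have "graded_class \<mu> (- F) \<oplus>\<^bsub>graded_ring \<mu>\<^esub> graded_class \<mu> F = \<zero>\<^bsub>graded_ring \<mu>\<^esub>"
        using P(3,5) by (metis add.left_inverse)
      moreover have "graded_class \<mu> F \<in> carrier (graded_ring \<mu>)" "graded_class \<mu> (- F) \<in> carrier (graded_ring \<mu>)"
        using R P(2) by blast+
      ultimately have "\<ominus>\<^bsub>graded_ring \<mu>\<^esub> s = graded_class \<mu> (- F)"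
        unfolding F(2) by (rule minus_equality)
      then show ?case using C(5) F(1) by (auto simp: a_inv_def)
    next
      case (eng s t)
      then obtain F G where "F \<in> chain_rees" "s = graded_class \<mu> F" "G \<in> chain_rees" "t = graded_class \<mu> G"
        by blast
      then show ?case
        using P(5)[of F G] C(3)[of F G] chain_rees_subset
        by (intro image_eqI[of _ _ "F + G"]) (simp_all add: subset_iff)
    qed
  next
    fix s assume "s \<in> graded_class \<mu> ` chain_rees"
    then show "s \<in> generate (add_monoid (graded_ring \<mu>)) {initial \<mu> f | f. degree f < degree Q}"
      using graded_class_in_generate by blast
  qed
  then show ?thesis
    using presents_subring[OF pres subring_of_chain_rees chain_rees_subset] by (simp add: R_sub_def)
qed

end

section \<open>The direct limit of the graded rings\<close>

theorem corollary4p13: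
  fixes \<nu>0 :: "'k::field \<Rightarrow> 'g::linordered_ab_group_add with_inf"
    and I :: "'i set"
    and \<nu> :: "'i \<Rightarrow> 'k poly \<Rightarrow> 'g with_inf"
    and Q :: "'k poly"
    and \<gamma> :: "'g with_inf"
    and \<mu> :: "'k poly \<Rightarrow> 'g with_inf"
  assumes "divisible_group TYPE('g)"
    and "valuation \<nu>0" and "val_support \<nu>0 = {0}"
    and "I \<noteq> {}" and "\<And>i. i \<in> I \<Longrightarrow> \<nu> i \<in> extensions \<nu>0"
    and "linear_order_on I {(i, j). i \<in> I \<and> j \<in> I \<and> \<nu> i \<le> \<nu> j}"
    and "\<not> (\<exists>m\<in>I. \<forall>i\<in>I. \<nu> i \<le> \<nu> m)"
    and "\<exists>f. \<not> v_stable I \<nu> f"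
    and "is_arg_min degree (\<lambda>f. lead_coeff f = 1 \<and> \<not> v_stable I \<nu> f) Q"
    and "\<And>i. i \<in> I \<Longrightarrow> \<nu> i Q < \<gamma>"
    and "\<mu> \<in> extensions \<nu>0"
    and "\<And>(f :: nat \<Rightarrow> 'k poly) r. (\<And>j. j \<le> r \<Longrightarrow> degree (f j) < degree Q) \<Longrightarrow>
           \<mu> (\<Sum>j\<le>r. f j * Q ^ j) = Min ((\<lambda>j. stable_value I \<nu> (f j) + nmul j \<gamma>) ` {..r})"
  shows "cring (direct_limit I (\<lambda>i j. \<nu> i \<le> \<nu> j) (\<lambda>i. graded_ring (\<nu> i))
                 (\<lambda>i j. graded_map (\<nu> i) (\<nu> j))) \<and>
         cring (R_sub \<mu> (degree Q)) \<and>
         direct_limit I (\<lambda>i j. \<nu> i \<le> \<nu> j) (\<lambda>i. graded_ring (\<nu> i))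
           (\<lambda>i j. graded_map (\<nu> i) (\<nu> j)) \<simeq> R_sub \<mu> (degree Q)"
proof -
  have val: "valuation (\<nu> i)" and const: "\<nu> i [:a:] = \<nu>0 a" if "i \<in> I" for i a
    using assms(5)[OF that] by (auto simp: extensions_def)
  have total: "\<nu> i \<le> \<nu> j \<or> \<nu> j \<le> \<nu> i" if ij: "i \<in> I" "j \<in> I" for i j
    using assms(6) ij by (cases "i = j") (auto simp: linear_order_on_def total_on_def)
  interpret valuation_chain I \<nu>
    by unfold_locales (use assms(4) val total in auto)
  \<comment> \<open>Multiplication by a constant shifts all values by the same amount, so minimality of \<open>Q\<close> among
    the monic unstable polynomials extends to all unstable polynomials.\<close>
  have smult: "v_stable I \<nu> (smult a f)" if "v_stable I \<nu> f" for a f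
  proof -
    have "eventually (\<lambda>k. \<nu> k (smult a f) = \<nu>0 a + stable_value I \<nu> f) tails"
      using eventually_mem eventually_stable_value[OF that]
    proof eventually_elim
      case (elim k)
      then show ?case using valuationD(1)[OF val, of k "[:a:]" f] const by simp
    qed
    then show ?thesis using v_stable_iff by blast
  qed
  have Q: "lead_coeff Q = 1" "\<not> v_stable I \<nu> Q"
    and minimal: "\<And>f. lead_coeff f = 1 \<Longrightarrow> degree f < degree Q \<Longrightarrow> v_stable I \<nu> f"
    using assms(9) by (auto simp: is_arg_min_def)
  have "eventually (\<lambda>k. \<nu> k 1 = Fin 0) tails"
    using eventually_mem by eventually_elim (simp add: valuationD(3)[OF val])
  then have one: "v_stable I \<nu> 1" using v_stable_iff by blast
  have "degree Q \<noteq> 0"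
  proof
    assume "degree Q = 0"
    then have "Q = 1" using Q(1) by (metis degree_eq_zeroE coeff_pCons_0 one_pCons)
    with one Q(2) show False by simp
  qed
  moreover have "v_stable I \<nu> f" if f: "degree f < degree Q" for f
  proof (cases "f = 0")
    case True
    then show ?thesis using smult[OF one, of 0] by simp
  next
    case False
    then have "v_stable I \<nu> (smult (inverse (lead_coeff f)) f)"
      using f by (intro minimal) auto
    then show ?thesis
      using smult[of "smult (inverse (lead_coeff f)) f" "lead_coeff f"] False by simp
  qed
  ultimately interpret limit_extension I \<nu> Q \<gamma> \<mu>
  proof unfold_locales
    show "\<mu> (\<Sum>j\<le>r. h j * Q ^ j) = Min ((\<lambda>j. stable_value I \<nu> (h j) + nmul j \<gamma>) ` {..r})"
      if "\<And>j. j \<le> r \<Longrightarrow> degree (h j) < degree Q" for h r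
      using that by (rule assms(12))
  qed (use Q assms(10,11) in \<open>simp_all add: extensions_def\<close>)
  have "\<exists>L. presents (\<Union>i\<in>I. rees (\<nu> i)) L
        (direct_limit I (\<lambda>i j. \<nu> i \<le> \<nu> j) (\<lambda>i. graded_ring (\<nu> i)) (\<lambda>i j. graded_map (\<nu> i) (\<nu> j))) \<and>
      (\<forall>F\<in>\<Union>i\<in>I. rees (\<nu> i). \<forall>G\<in>\<Union>i\<in>I. rees (\<nu> i).
        L F = L G \<longleftrightarrow> (\<exists>k\<in>I. F \<in> rees (\<nu> k) \<and> G \<in> rees (\<nu> k) \<and> graded_class (\<nu> k) F = graded_class (\<nu> k) G))"
  proof (rule presents_direct_limit)
    show "presents (rees (\<nu> i)) (graded_class (\<nu> i)) (graded_ring (\<nu> i))" if "i \<in> I" for i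
      by (rule presents_graded_ring[OF val[OF that]])
    show "graded_map (\<nu> i) (\<nu> j) (graded_class (\<nu> i) F) = graded_class (\<nu> j) F"
      if "i \<in> I" "j \<in> I" "\<nu> i \<le> \<nu> j" "F \<in> rees (\<nu> i)" for i j F
      using that val by (intro graded_map_graded_class)
    show "rees (\<nu> i) \<subseteq> rees (\<nu> j)" if "\<nu> i \<le> \<nu> j" for i j
      using that by (rule rees_mono)
    show "\<nu> i \<le> \<nu> k" if "\<nu> i \<le> \<nu> j" "\<nu> j \<le> \<nu> k" for i j k
      using that by (rule order_trans)
  qed (use nonempty total in simp_all)
  then obtain L where L: "presents chain_rees L
      (direct_limit I (\<lambda>i j. \<nu> i \<le> \<nu> j) (\<lambda>i. graded_ring (\<nu> i)) (\<lambda>i j. graded_map (\<nu> i) (\<nu> j)))"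
    and L_iff: "\<And>F G. F \<in> chain_rees \<Longrightarrow> G \<in> chain_rees \<Longrightarrow> L F = L G \<longleftrightarrow>
      (\<exists>k\<in>I. F \<in> rees (\<nu> k) \<and> G \<in> rees (\<nu> k) \<and> graded_class (\<nu> k) F = graded_class (\<nu> k) G)"
    unfolding chain_rees_def by blast
  have "L F = L G \<longleftrightarrow> graded_class \<mu> F = graded_class \<mu> G" if "F \<in> chain_rees" "G \<in> chain_rees" for F G
    using L_iff[OF that] graded_class_\<mu>_eq_iff[OF that] by blast
  then show ?thesis
    using presents_cring[OF L] presents_cring[OF presents_R_sub]
      presents_same_kernel_iso[OF L presents_R_sub] by blast
qed

end
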